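(* Let $k$ be a field, $I\subseteq k[x_1,\dots,x_n]$ an ideal, and $\prec_1,\prec_2$ rational term orders given by $\mathbb{Q}$-bases $\omega=(\omega_1,\dots,\omega_n)$ and $\tau=(\tau_1,\dots,\tau_n)$ of $\mathbb{Q}^n$, respectively. Then for every sufficiently small rational $\delta>0$, and every rational $\epsilon>0$ sufficiently small (depending on $\delta$), the following hold: $\omega_\delta$ lies in the interior of the Gröbner cone $C_{\prec_1}(I)$, $\tau_\epsilon$ lies in the interior of the Gröbner cone $C_{\prec_2}(I)$, and the line segment $\omega(t)=(1-t)\omega_\delta+t\tau_\epsilon$, $0\le t\le1$, intersects the cones of the Gröbner fan of $I$ only in dimension $\ge n-1$; that is, every point of the segment lies in the relative interior of a cone of the Gröbner fan of dimension $n$ or $n-1$ (so whenever it lies on a proper face of a Gröbner cone, the smallest face containing it is a facet).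
   Context: The rational group order given by a $\mathbb{Q}$-basis $\omega=(\omega_1,\dots,\omega_n)$ of $\mathbb{Q}^n$ is: $u\prec v$ iff $(\langle\omega_1,u\rangle,\dots,\langle\omega_n,u\rangle)$ is lexicographically smaller than $(\langle\omega_1,v\rangle,\dots,\langle\omega_n,v\rangle)$; it is a term order if $0\prec e_i$ for every canonical basis vector $e_i$. For rational $\eta>0$ put $\omega_\eta=\omega_1+\eta\omega_2+\cdots+\eta^{n-1}\omega_n$ and likewise $\tau_\eta=\tau_1+\eta\tau_2+\cdots+\eta^{n-1}\tau_n$. For a nonzero polynomial $f=\sum_va_vx^v$ let $\operatorname{supp}(f)=\{v\mid a_v\ne0\}$, and for a term order $\prec$ let $\partial_\prec(f)=\{u-u'\mid u'\in\operatorname{supp}(f)\setminus\{u\}\}$, where $u=\max_\prec\operatorname{supp}(f)$. The Gröbner cone of $I$ over $\prec$ is $C_\prec(I)=\{w\in\mathbb{R}^n_{\ge0}\mid\langle w,v\rangle\ge0\text{ for all }v\in\partial_\prec(f),\ f\in G\}$, where $G$ is the reduced Gröbner basis of $I$ over $\prec$. The Gröbner fan of $I$ is the (finite) set of cones $C_\prec(I)$, $\prec$ ranging over all term orders, together with their faces. A face of a cone $C$ is a set $u^\perp\cap C$ with $\langle u,c\rangle\ge 0$ for all $c\in C$; a facet is a face of codimension one in $C$; the dimension of a cone is the dimension of its linear span. *)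

theory Defs
  imports "HOL-Analysis.Analysis" "HOL-Library.Poly_Mapping"
begin

text \<open>
  The ring $k[x_1,\dots,x_n]$ is the type of finitely supported maps from exponent vectors in
  $\mathbb{N}^n$ to \<open>'k\<close>, with convolution as product; \<open>n\<close> is \<open>CARD('n)\<close>.
\<close>

type_synonym ('n, 'k) mpoly = "('n \<Rightarrow>\<^sub>0 nat) \<Rightarrow>\<^sub>0 'k"

definition is_ideal :: "'a::comm_ring_1 set \<Rightarrow> bool" where
  "is_ideal I \<longleftrightarrow> 0 \<in> I \<and> (\<forall>f\<in>I. \<forall>g\<in>I. f + g \<in> I) \<and> (\<forall>f\<in>I. \<forall>h. h * f \<in> I)"

definition rat_vec :: "rat ^ 'n \<Rightarrow> real ^ 'n" where
  "rat_vec w = (\<chi> i. real_of_rat (w $ i))"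

definition int_vec :: "int ^ 'n \<Rightarrow> real ^ 'n" where
  "int_vec v = (\<chi> i. real_of_int (v $ i))"

definition exponent :: "('n::finite \<Rightarrow>\<^sub>0 nat) \<Rightarrow> int ^ 'n" where
  "exponent m = (\<chi> i. int (Poly_Mapping.lookup m i))"


section \<open>Term orders\<close>

definition group_order :: "(int ^ 'n \<Rightarrow> int ^ 'n \<Rightarrow> bool) \<Rightarrow> bool" where
  "group_order prec \<longleftrightarrow> irreflp prec \<and> transp prec \<and> totalp prec \<and>
     (\<forall>u v w. prec u v \<longrightarrow> prec (u + w) (v + w))"

definition term_order :: "(int ^ 'n \<Rightarrow> int ^ 'n \<Rightarrow> bool) \<Rightarrow> bool" where
  "term_order prec \<longleftrightarrow> group_order prec \<and> (\<forall>i. prec 0 (axis i 1))"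

text \<open>
  A family $\omega_1,\dots,\omega_n$ is indexed from \<open>0\<close>: $\omega_{i+1}$ is \<open>\<omega> i\<close>, and the values of
  \<open>\<omega>\<close> outside \<open>{..<CARD('n)}\<close> are irrelevant.
\<close>

definition rat_basis :: "(nat \<Rightarrow> rat ^ 'n) \<Rightarrow> bool" where
  "rat_basis \<omega> \<longleftrightarrow> inj_on \<omega> {..<CARD('n)} \<and> vec.independent (\<omega> ` {..<CARD('n)}) \<and>
     vec.span (\<omega> ` {..<CARD('n)}) = UNIV"

definition rational_order :: "(nat \<Rightarrow> rat ^ 'n) \<Rightarrow> int ^ 'n \<Rightarrow> int ^ 'n \<Rightarrow> bool" where
  "rational_order \<omega> u v \<longleftrightarrow>
     (\<exists>i<CARD('n). rat_vec (\<omega> i) \<bullet> int_vec u < rat_vec (\<omega> i) \<bullet> int_vec v \<and>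
        (\<forall>j<i. rat_vec (\<omega> j) \<bullet> int_vec u = rat_vec (\<omega> j) \<bullet> int_vec v))"

definition perturbed :: "(nat \<Rightarrow> rat ^ 'n) \<Rightarrow> rat \<Rightarrow> rat ^ 'n" where
  "perturbed \<omega> \<eta> = (\<Sum>i<CARD('n). \<eta> ^ i *s \<omega> i)"


section \<open>Reduced Gr\<ouml>bner bases\<close>

definition lead_exp :: "(int ^ 'n \<Rightarrow> int ^ 'n \<Rightarrow> bool) \<Rightarrow> ('n::finite, 'k::field) mpoly \<Rightarrow> 'n \<Rightarrow>\<^sub>0 nat" where
  "lead_exp prec f =
     (THE m. m \<in> Poly_Mapping.keys f \<and> (\<forall>m'\<in>Poly_Mapping.keys f - {m}. prec (exponent m') (exponent m)))"

definition initial_term ::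
    "(int ^ 'n \<Rightarrow> int ^ 'n \<Rightarrow> bool) \<Rightarrow> ('n::finite, 'k::field) mpoly \<Rightarrow> ('n, 'k) mpoly" where
  "initial_term prec f = Poly_Mapping.single (lead_exp prec f) (Poly_Mapping.lookup f (lead_exp prec f))"

definition groebner_basis ::
    "(int ^ 'n \<Rightarrow> int ^ 'n \<Rightarrow> bool) \<Rightarrow> ('n::finite, 'k::field) mpoly set \<Rightarrow> ('n, 'k) mpoly set \<Rightarrow> bool" where
  "groebner_basis prec I G \<longleftrightarrow> finite G \<and> G \<subseteq> I - {0} \<and>
     is_ideal hull (initial_term prec ` G) = is_ideal hull (initial_term prec ` (I - {0}))"

definition is_reduced_groebner_basis ::
    "(int ^ 'n \<Rightarrow> int ^ 'n \<Rightarrow> bool) \<Rightarrow> ('n::finite, 'k::field) mpoly set \<Rightarrow> ('n, 'k) mpoly set \<Rightarrow> bool" where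
  "is_reduced_groebner_basis prec I G \<longleftrightarrow> groebner_basis prec I G \<and>
     (\<forall>g\<in>G. Poly_Mapping.lookup g (lead_exp prec g) = 1) \<and>
     (\<forall>f\<in>G. \<forall>g\<in>G - {f}. \<forall>m\<in>Poly_Mapping.keys f.
        \<not> initial_term prec g dvd Poly_Mapping.single m (Poly_Mapping.lookup f m))"

definition reduced_groebner_basis ::
    "(int ^ 'n \<Rightarrow> int ^ 'n \<Rightarrow> bool) \<Rightarrow> ('n::finite, 'k::field) mpoly set \<Rightarrow> ('n, 'k) mpoly set" where
  "reduced_groebner_basis prec I = (THE G. is_reduced_groebner_basis prec I G)"


section \<open>Cones, faces and the Gr\<ouml>bner fan\<close>

definition lead_diffs ::
    "(int ^ 'n \<Rightarrow> int ^ 'n \<Rightarrow> bool) \<Rightarrow> ('n::finite, 'k::field) mpoly \<Rightarrow> (int ^ 'n) set" where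
  "lead_diffs prec f =
     {exponent (lead_exp prec f) - exponent m | m. m \<in> Poly_Mapping.keys f - {lead_exp prec f}}"

definition groebner_cone ::
    "(int ^ 'n \<Rightarrow> int ^ 'n \<Rightarrow> bool) \<Rightarrow> ('n::finite, 'k::field) mpoly set \<Rightarrow> (real ^ 'n) set" where
  "groebner_cone prec I =
     {w. (\<forall>i. 0 \<le> w $ i) \<and>
         (\<forall>f\<in>reduced_groebner_basis prec I. \<forall>v\<in>lead_diffs prec f. 0 \<le> w \<bullet> int_vec v)}"

text \<open>
  Faces of cones are cut out by supporting hyperplanes through the origin. This differs from
  \<^const>\<open>face_of\<close>, for which the empty set is also a face. The codimension of a face is taken with
  respect to \<^const>\<open>dim\<close>, the dimension of the linear span.
\<close>

definition cone_face :: "(real ^ 'n) set \<Rightarrow> (real ^ 'n) set \<Rightarrow> bool" where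
  "cone_face F C \<longleftrightarrow> (\<exists>u. (\<forall>c\<in>C. 0 \<le> u \<bullet> c) \<and> F = {c \<in> C. u \<bullet> c = 0})"

definition cone_facet :: "(real ^ 'n) set \<Rightarrow> (real ^ 'n) set \<Rightarrow> bool" where
  "cone_facet F C \<longleftrightarrow> cone_face F C \<and> dim F + 1 = dim C"

definition groebner_fan :: "('n::finite, 'k::field) mpoly set \<Rightarrow> (real ^ 'n) set set" where
  "groebner_fan I =
     {groebner_cone prec I | prec. term_order prec} \<union>
     {F. \<exists>prec. term_order prec \<and> cone_face F (groebner_cone prec I)}"

end

theory Submission
  imports Defs
begin

text \<open>
  The walls of the Gr\<ouml>bner fan lie in finitely many hyperplanes: the coordinate hyperplanes, which the
  segment avoids because both its end points are positive, and those orthogonal to the vectors in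
  \<open>fan_diffs I\<close>. The idea is to show that every point \<open>p\<close> of the segment lies on at most one of them.

  For \<open>\<delta>\<close> small, $\omega_\delta$ is strictly positive on the finitely many normals of its Gr\<ouml>bner cone,
  since the first basis vector on which a normal does not vanish dominates; and it lies on none of the
  hyperplanes, since a nonzero polynomial in \<open>\<delta>\<close> has no zeros close to \<open>0\<close> other than \<open>0\<close>. With \<open>\<delta>\<close>
  fixed, a point of the segment can lie on two different hyperplanes $v^\perp$, $w^\perp$ only if
  $\tau_\epsilon$ is orthogonal to
  $\langle v,\omega_\delta\rangle w-\langle w,\omega_\delta\rangle v\neq0$ (\<open>segment_generic\<close>). Each
  pair thus excludes only the zeros of a nonzero polynomial in \<open>\<epsilon>\<close>, and there are finitely many pairs.

  Refining the weight \<open>p\<close> to a term order exhibits a Gr\<ouml>bner cone containing \<open>p\<close>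
  (\<open>mem_groebner_cone_refine_order\<close>). If a Gr\<ouml>bner cone contains \<open>p\<close> and \<open>p\<close> is on no wall of it, then
  \<open>p\<close> is in its interior. Otherwise its normals at \<open>p\<close> are all parallel, and they are positive multiples
  of each other since all are positive for the term order; so the cone is a half-space near \<open>p\<close>, and its
  intersection with the wall is a facet with \<open>p\<close> in its relative interior, hence the smallest face
  containing \<open>p\<close> (\<open>generic_cases\<close>).

  It remains to see that reduced Gr\<ouml>bner bases exist and are unique, and that only finitely many occur.
  The reduced basis consists of the elements $x^m-r_m$ of \<open>I\<close>, where $x^m$ is a minimal generator of the
  initial ideal and $r_m$ has no monomial in the initial ideal. So it is determined by the initial ideal,
  and there are only finitely many initial ideals (\<open>finite_lead_sets\<close>), by Noetherian induction over
  monomial ideals.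
\<close>

abbreviation supp :: "('a \<Rightarrow>\<^sub>0 'b::zero) \<Rightarrow> 'a set" where
  "supp \<equiv> Poly_Mapping.keys"

abbreviation coeff :: "('a \<Rightarrow>\<^sub>0 'b::zero) \<Rightarrow> 'a \<Rightarrow> 'b" where
  "coeff \<equiv> Poly_Mapping.lookup"

section \<open>Divisibility of monomials and Dickson's lemma\<close>

definition mono_dvd :: "('n \<Rightarrow>\<^sub>0 nat) \<Rightarrow> ('n \<Rightarrow>\<^sub>0 nat) \<Rightarrow> bool" (infix "\<sqsubseteq>" 50) where
  "m \<sqsubseteq> k \<longleftrightarrow> (\<forall>i. coeff m i \<le> coeff k i)"

lemma mono_dvd_refl [simp]: "m \<sqsubseteq> m"
  by (simp add: mono_dvd_def)

lemma mono_dvd_trans: "a \<sqsubseteq> b \<Longrightarrow> b \<sqsubseteq> c \<Longrightarrow> a \<sqsubseteq> c"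
  unfolding mono_dvd_def using order_trans by blast

lemma mono_dvd_antisym: "a \<sqsubseteq> b \<Longrightarrow> b \<sqsubseteq> a \<Longrightarrow> a = b"
  unfolding mono_dvd_def by (intro poly_mapping_eqI antisym) auto

lemma mono_dvd_add: "m \<sqsubseteq> d + m"
  by (simp add: mono_dvd_def lookup_add)

lemma mono_dvd_diff: "m \<sqsubseteq> k \<Longrightarrow> (k - m) + m = k"
  unfolding mono_dvd_def by (intro poly_mapping_eqI) (simp add: lookup_add lookup_minus)

text \<open>
  A monotone subsequence exists in any linear order; if it happens to descend, then from a place
  where its minimum is attained onwards it is constant, hence ascending.
\<close>

lemma nat_seq_mono_subseq:
  fixes x :: "nat \<Rightarrow> nat"
  shows "\<exists>r :: nat \<Rightarrow> nat. strict_mono r \<and> mono (\<lambda>i. x (r i))"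
proof -
  obtain f where f: "strict_mono f" "monoseq (\<lambda>n. x (f n))"
    using seq_monosub[of x] by blast
  show ?thesis
  proof (cases "\<forall>m n. m \<le> n \<longrightarrow> x (f m) \<le> x (f n)")
    case True
    then have "mono (\<lambda>i. x (f i))" by (simp add: mono_def)
    then show ?thesis using f(1) by blast
  next
    case False
    then have dec: "\<And>m n. m \<le> n \<Longrightarrow> x (f n) \<le> x (f m)"
      using f(2) unfolding monoseq_def by blast
    obtain N where N: "\<And>n. x (f N) \<le> x (f n)"
      using ex_has_least_nat[of "\<lambda>_. True" _ "\<lambda>n. x (f n)"] by auto
    have "x (f (i + N)) = x (f N)" for i
      using dec[of N "i + N"] N[of "i + N"] by simp
    moreover have "strict_mono (\<lambda>i. f (i + N))"
      using f(1) by (simp add: strict_mono_def)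
    ultimately show ?thesis by (intro exI[of _ "\<lambda>i. f (i + N)"]) (auto simp: mono_def)
  qed
qed

text \<open>
  Refining to an ascending subsequence one coordinate at a time makes all finitely many
  coordinates ascend simultaneously. Well-foundedness of term orders, finiteness of minimal generating
  sets and the ascending chain condition for monomial ideals all follow from this.
\<close>

lemma dickson:
  fixes s :: "nat \<Rightarrow> ('n::finite \<Rightarrow>\<^sub>0 nat)"
  shows "\<exists>i j. i < j \<and> s i \<sqsubseteq> s j"
proof -
  have "finite C \<Longrightarrow> \<exists>r :: nat \<Rightarrow> nat. strict_mono r \<and> (\<forall>c\<in>C. mono (\<lambda>i. coeff (s (r i)) c))" for C
  proof (induction C rule: finite_induct)
    case empty
    show ?case using strict_mono_id by blast
  next
    case (insert c C)
    then obtain r :: "nat \<Rightarrow> nat" where r: "strict_mono r" "\<forall>c\<in>C. mono (\<lambda>i. coeff (s (r i)) c)" by blast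
    obtain q :: "nat \<Rightarrow> nat" where q: "strict_mono q" "mono (\<lambda>i. coeff (s (r (q i))) c)"
      using nat_seq_mono_subseq[of "\<lambda>i. coeff (s (r i)) c"] by blast
    have "mono (\<lambda>i. coeff (s (r (q i))) d)" if "d \<in> C" for d
      using r(2) that q(1) by (metis (mono_tags, lifting) mono_def strict_mono_less_eq)
    then show ?case using r(1) q
      by (intro exI[of _ "\<lambda>i. r (q i)"]) (auto simp: strict_mono_def)
  qed
  from this[of UNIV] obtain r :: "nat \<Rightarrow> nat"
    where r: "strict_mono r" "\<And>c. mono (\<lambda>i. coeff (s (r i)) c)" by auto
  have "r 0 < r 1" using r(1) by (simp add: strict_mono_def)
  moreover have "s (r 0) \<sqsubseteq> s (r 1)" unfolding mono_dvd_def using r(2) by (auto simp: mono_def)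
  ultimately show ?thesis by blast
qed

lemma wf_no_divisor_above:
  fixes R :: "('n::finite \<Rightarrow>\<^sub>0 nat) \<Rightarrow> ('n \<Rightarrow>\<^sub>0 nat) \<Rightarrow> bool"
  assumes "transp R" and "\<And>a b. a \<sqsubseteq> b \<Longrightarrow> \<not> R b a"
  shows "wfp R"
  unfolding wfp_def wf_iff_no_infinite_down_chain
proof
  assume "\<exists>f. \<forall>i. (f (Suc i), f i) \<in> {(x, y). R x y}"
  then obtain f where f: "\<And>i. R (f (Suc i)) (f i)" by auto
  have "R (f j) (f i)" if "i < j" for i j
    using that
  proof (induction rule: less_Suc_induct)
    case (2 i j k)
    then show ?case using assms(1) by (meson transpE)
  qed (rule f)
  then show False using dickson[of f] assms(2) by blast
qed

lemma finite_antichain: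
  fixes A :: "('n::finite \<Rightarrow>\<^sub>0 nat) set"
  assumes "\<And>a b. a \<in> A \<Longrightarrow> b \<in> A \<Longrightarrow> a \<sqsubseteq> b \<Longrightarrow> a = b"
  shows "finite A"
proof (rule ccontr)
  assume "infinite A"
  then obtain s :: "nat \<Rightarrow> _" where s: "inj s" "range s \<subseteq> A"
    using infinite_countable_subset by blast
  obtain i j where "i < j" "s i \<sqsubseteq> s j" using dickson[of s] by blast
  then show False using assms[of "s i" "s j"] s by (auto dest: injD)
qed

definition mono_min :: "('n \<Rightarrow>\<^sub>0 nat) set \<Rightarrow> ('n \<Rightarrow>\<^sub>0 nat) set" where
  "mono_min L = {m \<in> L. \<forall>l\<in>L. l \<sqsubseteq> m \<longrightarrow> l = m}"

lemma finite_mono_min: "finite (mono_min (L :: ('n::finite \<Rightarrow>\<^sub>0 nat) set))"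
  by (rule finite_antichain) (auto simp: mono_min_def)

lemma mono_min_below:
  fixes L :: "('n::finite \<Rightarrow>\<^sub>0 nat) set"
  assumes "k \<in> L"
  obtains m where "m \<in> mono_min L" "m \<sqsubseteq> k"
proof -
  have wf: "wfp (\<lambda>a b :: 'n \<Rightarrow>\<^sub>0 nat. a \<sqsubseteq> b \<and> a \<noteq> b)"
  proof (rule wf_no_divisor_above)
    show "transp (\<lambda>a b :: 'n \<Rightarrow>\<^sub>0 nat. a \<sqsubseteq> b \<and> a \<noteq> b)"
      by (rule transpI) (metis mono_dvd_trans mono_dvd_antisym)
  qed (metis mono_dvd_antisym)
  have "k \<in> L \<Longrightarrow> \<exists>m\<in>mono_min L. m \<sqsubseteq> k"
    using wf
  proof (induction k rule: wfp_induct_rule)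
    case (less k)
    show ?case
    proof (cases "k \<in> mono_min L")
      case True
      then show ?thesis using mono_dvd_refl by blast
    next
      case False
      then obtain l where "l \<in> L" "l \<sqsubseteq> k" "l \<noteq> k" using less.prems by (auto simp: mono_min_def)
      then show ?thesis using less.IH by (meson mono_dvd_trans)
    qed
  qed
  then show thesis using assms that by blast
qed

text \<open>
  Monomial ideals, represented by the set of exponents of their monomials.
\<close>

definition mono_upset :: "('n \<Rightarrow>\<^sub>0 nat) set \<Rightarrow> bool" where
  "mono_upset M \<longleftrightarrow> (\<forall>m\<in>M. \<forall>k. m \<sqsubseteq> k \<longrightarrow> k \<in> M)"

text \<open>
  The relation goes from a monomial ideal to a strictly larger one, so this is the ascending chain
  condition, in the form needed for Noetherian induction. Along an infinite chain, pick one new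
  monomial per step; by Dickson's lemma an earlier one divides a later one, which is then not new.
\<close>

lemma wf_mono_upset:
  "wf {(M', M). mono_upset (M' :: ('n::finite \<Rightarrow>\<^sub>0 nat) set) \<and> mono_upset M \<and> M \<subset> M'}"
  unfolding wf_iff_no_infinite_down_chain
proof
  assume "\<exists>f. \<forall>i. (f (Suc i), f i) \<in>
    {(M', M). mono_upset (M' :: ('n \<Rightarrow>\<^sub>0 nat) set) \<and> mono_upset M \<and> M \<subset> M'}"
  then obtain f :: "nat \<Rightarrow> ('n \<Rightarrow>\<^sub>0 nat) set"
    where chain: "\<forall>i. (f (Suc i), f i) \<in> {(M', M). mono_upset M' \<and> mono_upset M \<and> M \<subset> M'}" ..
  have f: "mono_upset (f i)" "f i \<subset> f (Suc i)" for i
    using chain[rule_format, of i] by auto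
  have "\<forall>i. \<exists>x. x \<in> f (Suc i) - f i" using f(2) by blast
  then obtain s where s: "\<And>i. s i \<in> f (Suc i) - f i" by metis
  obtain i j where ij: "i < j" "s i \<sqsubseteq> s j" using dickson[of s] by blast
  have "f (Suc i) \<subseteq> f j" using lift_Suc_mono_le[of f "Suc i" j] f(2) ij(1) by (simp add: psubset_imp_subset Suc_leI)
  then have "s j \<in> f j" using s[of i] f(1)[of j] ij(2) unfolding mono_upset_def by blast
  then show False using s[of j] by blast
qed

section \<open>Term orders on monomials\<close>

lemma exponent_add: "exponent (a + b) = exponent a + exponent b"
  by (simp add: exponent_def lookup_add vec_eq_iff)

lemma exponent_inject [simp]: "exponent a = exponent b \<longleftrightarrow> a = b"
  by (auto simp: exponent_def vec_eq_iff intro: poly_mapping_eqI)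

lemma term_order_irrefl: "term_order prec \<Longrightarrow> \<not> prec u u"
  by (simp add: term_order_def group_order_def irreflpD)

lemma term_order_trans: "term_order prec \<Longrightarrow> prec u v \<Longrightarrow> prec v w \<Longrightarrow> prec u w"
  unfolding term_order_def group_order_def by (meson transpE)

lemma term_order_total: "term_order prec \<Longrightarrow> u \<noteq> v \<Longrightarrow> prec u v \<or> prec v u"
  using totalpD[of prec u v] by (auto simp: term_order_def group_order_def)

lemma term_order_translate: "term_order prec \<Longrightarrow> prec u v \<Longrightarrow> prec (u + w) (v + w)"
  unfolding term_order_def group_order_def by blast

lemma term_order_add_pos:
  assumes prec: "term_order prec" and "prec 0 u" "prec 0 v"
  shows "prec 0 (u + v)"
proof -
  have "prec v (u + v)" using term_order_translate[OF prec assms(2), of v] by simp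
  then show ?thesis using term_order_trans[OF prec assms(3)] by blast
qed

lemma term_order_add_nonneg:
  assumes "term_order prec" "u = 0 \<or> prec 0 u" "v = 0 \<or> prec 0 v"
  shows "u + v = 0 \<or> prec 0 (u + v)"
  using assms term_order_add_pos[OF assms(1)] by auto

lemma term_order_pos_iff: "term_order prec \<Longrightarrow> prec u v \<longleftrightarrow> prec 0 (v - u)"
  using term_order_translate[of prec u v "- u"] term_order_translate[of prec 0 "v - u" u] by auto

text \<open>
  A vector in $\mathbb{N}^n$ is a sum of canonical basis vectors, so it is positive unless it is zero.
  Consequently divisibility of monomials is refined by every term order.
\<close>

lemma term_order_nonneg:
  fixes v :: "int ^ 'n"
  assumes prec: "term_order prec" and "\<And>i. 0 \<le> v $ i"
  shows "v = 0 \<or> prec 0 v"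
proof -
  have ax: "axis i (int k) = 0 \<or> prec 0 (axis i (int k))" for i k
  proof (induction k)
    case (Suc k)
    have "axis i (int (Suc k)) = axis i (int k) + axis i 1"
      by (simp add: axis_def vec_eq_iff)
    then show ?case
      using term_order_add_nonneg[OF prec Suc, of "axis i 1"] prec by (simp add: term_order_def)
  qed (simp add: axis_def vec_eq_iff)
  have "finite S \<Longrightarrow> (\<Sum>i\<in>S. axis i (v $ i)) = 0 \<or> prec 0 (\<Sum>i\<in>S. axis i (v $ i))" for S
  proof (induction S rule: finite_induct)
    case (insert i S)
    have "axis i (v $ i) = 0 \<or> prec 0 (axis i (v $ i))"
      using ax[of i "nat (v $ i)"] assms(2)[of i] by simp
    then show ?case using term_order_add_nonneg[OF prec _ insert.IH] insert.hyps by simp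
  qed simp
  moreover have "(\<Sum>i\<in>UNIV. axis i (v $ i)) = v"
    by (simp add: vec_eq_iff axis_def if_distrib[of "\<lambda>x. x $ _"] cong: if_cong)
  ultimately show ?thesis using finite[of "UNIV :: 'n set"] by metis
qed

lemma term_order_mono_dvd:
  assumes "term_order prec" "m \<sqsubseteq> k" "m \<noteq> k"
  shows "prec (exponent m) (exponent k)"
proof -
  have "exponent k - exponent m = 0 \<or> prec 0 (exponent k - exponent m)"
    using assms(2) by (intro term_order_nonneg[OF assms(1)]) (simp add: mono_dvd_def exponent_def)
  then show ?thesis using assms(3) term_order_pos_iff[OF assms(1)] by force
qed

lemma term_order_wf:
  fixes prec :: "int ^ 'n \<Rightarrow> int ^ 'n \<Rightarrow> bool"
  assumes "term_order prec"
  shows "wfp (\<lambda>m k :: 'n::finite \<Rightarrow>\<^sub>0 nat. prec (exponent m) (exponent k))"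
proof (rule wf_no_divisor_above)
  show "transp (\<lambda>m k :: 'n \<Rightarrow>\<^sub>0 nat. prec (exponent m) (exponent k))"
    by (rule transpI) (rule term_order_trans[OF assms])
  show "\<not> prec (exponent b) (exponent a)" if "a \<sqsubseteq> b" for a b :: "'n \<Rightarrow>\<^sub>0 nat"
  proof
    assume ba: "prec (exponent b) (exponent a)"
    then have "a \<noteq> b" using term_order_irrefl[OF assms] by auto
    then have "prec (exponent b) (exponent b)"
      using term_order_trans[OF assms ba] term_order_mono_dvd[OF assms that] by simp
    then show False using term_order_irrefl[OF assms] by blast
  qed
qed

lemma lead_exp_unique:
  assumes prec: "term_order prec" and "m \<in> supp f"
    and "\<forall>m'\<in>supp f - {m}. prec (exponent m') (exponent m)"
  shows "lead_exp prec f = m"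
  unfolding lead_exp_def
proof (rule the_equality)
  fix k assume k: "k \<in> supp f \<and> (\<forall>m'\<in>supp f - {k}. prec (exponent m') (exponent k))"
  show "k = m"
  proof (rule ccontr)
    assume "k \<noteq> m"
    then have "prec (exponent m) (exponent k)" "prec (exponent k) (exponent m)"
      using k assms(2,3) by auto
    then show False using term_order_irrefl[OF prec] term_order_trans[OF prec] by blast
  qed
qed (use assms in auto)

lemma lead_exp_max:
  assumes prec: "term_order prec" and f: "f \<noteq> 0"
  shows "lead_exp prec f \<in> supp f"
    and "\<And>m. m \<in> supp f \<Longrightarrow> m \<noteq> lead_exp prec f \<Longrightarrow> prec (exponent m) (exponent (lead_exp prec f))"
proof -
  have "finite S \<Longrightarrow> S \<noteq> {} \<Longrightarrow> \<exists>m\<in>S. \<forall>m'\<in>S - {m}. prec (exponent m') (exponent m)"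
    for S :: "('a \<Rightarrow>\<^sub>0 nat) set"
  proof (induction S rule: finite_ne_induct)
    case (insert x S)
    then obtain m where m: "m \<in> S" "\<forall>m'\<in>S - {m}. prec (exponent m') (exponent m)" by blast
    have "x \<noteq> m" using insert m by blast
    then consider "prec (exponent x) (exponent m)" | "prec (exponent m) (exponent x)"
      using term_order_total[OF prec, of "exponent x" "exponent m"] by auto
    then show ?case
    proof cases
      case 1 then show ?thesis using m by blast
    next
      case 2 then show ?thesis using m term_order_trans[OF prec] by blast
    qed
  qed auto
  from this[of "supp f"] obtain m where m: "m \<in> supp f" "\<forall>m'\<in>supp f - {m}. prec (exponent m') (exponent m)"
    using f by auto
  with lead_exp_unique[OF prec m] show "lead_exp prec f \<in> supp f"
    "\<And>m. m \<in> supp f \<Longrightarrow> m \<noteq> lead_exp prec f \<Longrightarrow> prec (exponent m) (exponent (lead_exp prec f))"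
    by auto
qed


section \<open>Initial ideals\<close>

lemma coeff_single_times: "coeff (Poly_Mapping.single d c * f) (d + k) = c * coeff f k"
  for f :: "('a::cancel_comm_monoid_add) \<Rightarrow>\<^sub>0 'k::comm_ring_1"
  by (simp add: lookup_mult lookup_single when_mult)

lemma is_ideal_smult:
  fixes I :: "('n::finite, 'k::field) mpoly set"
  assumes "is_ideal I" "f \<in> I"
  shows "Poly_Mapping.single 0 c * f \<in> I"
  using assms unfolding is_ideal_def by blast

lemma is_ideal_diff:
  fixes I :: "'a::comm_ring_1 set"
  assumes "is_ideal I" "f \<in> I" "g \<in> I"
  shows "f - g \<in> I"
proof -
  have "(- 1) * g \<in> I" using assms unfolding is_ideal_def by blast
  then have "f + (- 1) * g \<in> I" using assms unfolding is_ideal_def by blast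
  then show ?thesis by simp
qed

lemma is_ideal_sum:
  fixes I :: "'a::comm_ring_1 set"
  assumes "is_ideal I" "\<And>x. x \<in> S \<Longrightarrow> f x \<in> I"
  shows "sum f S \<in> I"
  using assms(2)
proof (induction S rule: infinite_finite_induct)
  case (insert x S)
  then show ?case using assms(1) unfolding is_ideal_def by auto
qed (use assms(1) in \<open>auto simp: is_ideal_def\<close>)

lemma coeff_smult: "coeff (Poly_Mapping.single 0 c * f) k = c * coeff f k"
  for f :: "('n::finite, 'k::field) mpoly"
  using coeff_single_times[of 0 c f k] by simp

definition lead_set ::
    "(int ^ 'n \<Rightarrow> int ^ 'n \<Rightarrow> bool) \<Rightarrow> ('n::finite, 'k::field) mpoly set \<Rightarrow> ('n \<Rightarrow>\<^sub>0 nat) set" where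
  "lead_set prec I = lead_exp prec ` (I - {0})"

lemma lead_set_inter_supp:
  "term_order prec \<Longrightarrow> f \<in> I \<Longrightarrow> f \<noteq> 0 \<Longrightarrow> lead_exp prec f \<in> supp f \<inter> lead_set prec I"
  by (simp add: lead_set_def lead_exp_max)

lemma mono_upset_lead_set:
  fixes I :: "('n::finite, 'k::field) mpoly set"
  assumes I: "is_ideal I" and prec: "term_order prec"
  shows "mono_upset (lead_set prec I)"
  unfolding mono_upset_def
proof (intro ballI allI impI)
  fix m k assume "m \<in> lead_set prec I" and mk: "m \<sqsubseteq> k"
  then obtain f where f: "f \<in> I" "f \<noteq> 0" "lead_exp prec f = m" by (auto simp: lead_set_def)
  define d where "d = k - m"
  have k: "d + m = k" using mono_dvd_diff[OF mk] by (simp add: d_def)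
  define h where "h = Poly_Mapping.single d 1 * f"
  have hI: "h \<in> I" using I f(1) unfolding h_def is_ideal_def by blast
  have m: "m \<in> supp f" using lead_exp_max(1)[OF prec f(2)] f(3) by simp
  have kh: "k \<in> supp h"
    using m coeff_single_times[of d 1 f m] by (simp add: h_def k in_keys_iff)
  have "prec (exponent l) (exponent k)" if l: "l \<in> supp h - {k}" for l
  proof -
    obtain b where b: "l = d + b" "b \<in> supp f"
      using l keys_mult[of "Poly_Mapping.single d 1" f] by (auto simp: h_def)
    then have "prec (exponent b) (exponent m)"
      using lead_exp_max(2)[OF prec f(2) b(2)] f(3) l k by auto
    then show ?thesis
      using term_order_translate[OF prec, of "exponent b" "exponent m" "exponent d"]
      by (simp add: b(1) k[symmetric] exponent_add add.commute)
  qed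
  then have "lead_exp prec h = k" using lead_exp_unique[OF prec kh] by blast
  then show "k \<in> lead_set prec I" using hI kh by (force simp: lead_set_def)
qed

lemma single_dvd_single_imp:
  fixes c d :: "'k::field"
  assumes "Poly_Mapping.single (m :: 'n::finite \<Rightarrow>\<^sub>0 nat) c dvd Poly_Mapping.single k d" "d \<noteq> 0"
  shows "m \<sqsubseteq> k"
proof -
  obtain h where "Poly_Mapping.single k d = Poly_Mapping.single m c * h" using assms(1) by (auto elim: dvdE)
  moreover have "k \<in> supp (Poly_Mapping.single k d)" using assms(2) by simp
  ultimately obtain a b where "k = a + b" "a \<in> supp (Poly_Mapping.single m c)"
    using keys_mult[of "Poly_Mapping.single m c" h] by auto
  then show ?thesis using mono_dvd_add[of m b] by (auto simp: add.commute split: if_splits)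
qed

lemma single_dvd_single:
  fixes c d :: "'k::field"
  assumes "(m :: 'n::finite \<Rightarrow>\<^sub>0 nat) \<sqsubseteq> k" "c \<noteq> 0"
  shows "Poly_Mapping.single m c dvd Poly_Mapping.single k d"
proof
  show "Poly_Mapping.single k d = Poly_Mapping.single m c * Poly_Mapping.single (k - m) (d / c)"
    using mono_dvd_diff[OF assms(1)] assms(2) by (simp add: mult_single add.commute)
qed

lemma initial_term_dvd_iff:
  fixes g :: "('n::finite, 'k::field) mpoly"
  assumes "term_order prec" "g \<noteq> 0" "c \<noteq> 0"
  shows "initial_term prec g dvd Poly_Mapping.single m c \<longleftrightarrow> lead_exp prec g \<sqsubseteq> m"
  using single_dvd_single_imp[of "lead_exp prec g" _ m c] single_dvd_single[of "lead_exp prec g" m _ c]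
    lead_exp_max(1)[OF assms(1,2)] assms(3)
  by (auto simp: initial_term_def in_keys_iff)

lemma sum_single_supp: "f = (\<Sum>k\<in>supp f. Poly_Mapping.single k (coeff f k))"
proof (rule poly_mapping_eqI)
  fix l
  show "coeff f l = coeff (\<Sum>k\<in>supp f. Poly_Mapping.single k (coeff f k)) l"
    by (cases "l \<in> supp f") (auto simp: lookup_sum lookup_single when_def in_keys_iff sum.delta)
qed

text \<open>
  An ideal generated by monomials contains exactly the polynomials all of whose monomials are
  multiples of a generator. This translates Gr\<ouml>bner bases into divisibility of exponents.
\<close>

lemma initial_ideal_eq:
  fixes G :: "('n::finite, 'k::field) mpoly set"
  assumes prec: "term_order prec" and "0 \<notin> G"
  shows "is_ideal hull (initial_term prec ` G) = {f. \<forall>k\<in>supp f. \<exists>g\<in>G. lead_exp prec g \<sqsubseteq> k}"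
    (is "_ = ?M")
proof (rule hull_unique)
  show "initial_term prec ` G \<subseteq> ?M"
  proof (intro subsetI CollectI ballI)
    fix f k assume "f \<in> initial_term prec ` G" "k \<in> supp f"
    then obtain g where "g \<in> G" "k = lead_exp prec g"
      by (auto simp: initial_term_def split: if_splits)
    then show "\<exists>g\<in>G. lead_exp prec g \<sqsubseteq> k" using mono_dvd_refl by blast
  qed
  show "is_ideal ?M"
    unfolding is_ideal_def
  proof (intro conjI ballI allI)
    fix f g assume "f \<in> ?M" "g \<in> ?M"
    then show "f + g \<in> ?M" using keys_add[of f g] by blast
  next
    fix f h assume f: "f \<in> ?M"
    have "\<exists>g\<in>G. lead_exp prec g \<sqsubseteq> k" if k: "k \<in> supp (h * f)" for k
    proof -
      obtain a b where "k = a + b" "b \<in> supp f" using k keys_mult[of h f] by blast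
      then show ?thesis using f mono_dvd_add[of b a] mono_dvd_trans by blast
    qed
    then show "h * f \<in> ?M" by blast
  qed simp
next
  fix J assume J: "initial_term prec ` G \<subseteq> J" "is_ideal J"
  show "?M \<subseteq> J"
  proof
    fix f assume f: "f \<in> ?M"
    have "Poly_Mapping.single k (coeff f k) \<in> J" if k: "k \<in> supp f" for k
    proof -
      obtain g where g: "g \<in> G" "lead_exp prec g \<sqsubseteq> k" using f k by blast
      then have "initial_term prec g dvd Poly_Mapping.single k (coeff f k)"
        using initial_term_dvd_iff[OF prec, of g "coeff f k" k] assms(2) k by (auto simp: in_keys_iff)
      then obtain h where "Poly_Mapping.single k (coeff f k) = h * initial_term prec g"
        by (metis dvdE mult.commute)
      then show ?thesis using J g(1) unfolding is_ideal_def by auto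
    qed
    then show "f \<in> J" by (subst sum_single_supp) (rule is_ideal_sum[OF J(2)])
  qed
qed

lemma groebner_basis_iff:
  fixes I :: "('n::finite, 'k::field) mpoly set"
  assumes prec: "term_order prec"
  shows "groebner_basis prec I G \<longleftrightarrow>
    finite G \<and> G \<subseteq> I - {0} \<and> (\<forall>m\<in>lead_set prec I. \<exists>g\<in>G. lead_exp prec g \<sqsubseteq> m)"
proof -
  have "is_ideal hull (initial_term prec ` G) = is_ideal hull (initial_term prec ` (I - {0})) \<longleftrightarrow>
      (\<forall>m\<in>lead_set prec I. \<exists>g\<in>G. lead_exp prec g \<sqsubseteq> m)" (is "?A = ?B \<longleftrightarrow> ?C") if G: "G \<subseteq> I - {0}"
  proof -
    have A: "?A = {f. \<forall>k\<in>supp f. \<exists>g\<in>G. lead_exp prec g \<sqsubseteq> k}"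
      using G by (intro initial_ideal_eq[OF prec]) auto
    have B: "?B = {f. \<forall>k\<in>supp f. \<exists>g\<in>I - {0}. lead_exp prec g \<sqsubseteq> k}"
      by (intro initial_ideal_eq[OF prec]) auto
    show ?thesis
    proof
      assume eq: "?A = ?B"
      show ?C
      proof
        fix m assume "m \<in> lead_set prec I"
        then obtain f where "f \<in> I - {0}" "m = lead_exp prec f" by (auto simp: lead_set_def)
        then have "Poly_Mapping.single m 1 \<in> ?B" unfolding B by (auto intro!: bexI[of _ f])
        then show "\<exists>g\<in>G. lead_exp prec g \<sqsubseteq> m" unfolding eq[symmetric] A by simp
      qed
    next
      assume C: ?C
      have "(\<exists>g\<in>G. lead_exp prec g \<sqsubseteq> k) \<longleftrightarrow> (\<exists>g\<in>I - {0}. lead_exp prec g \<sqsubseteq> k)" for k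
      proof
        assume "\<exists>g\<in>I - {0}. lead_exp prec g \<sqsubseteq> k"
        then obtain f where f: "f \<in> I - {0}" "lead_exp prec f \<sqsubseteq> k" by blast
        then have "lead_exp prec f \<in> lead_set prec I" by (simp add: lead_set_def)
        then show "\<exists>g\<in>G. lead_exp prec g \<sqsubseteq> k" using C f(2) mono_dvd_trans by blast
      qed (use G in blast)
      then show "?A = ?B" unfolding A B by simp
    qed
  qed
  then show ?thesis unfolding groebner_basis_def by blast
qed

section \<open>The reduced Gr\<ouml>bner basis\<close>

text \<open>
  When \<open>L\<close> is the set of leading exponents of \<open>I\<close>, this says that \<open>f\<close> is $x^m$ minus its normal
  form modulo \<open>I\<close>. The term order enters only through \<open>L\<close>.
\<close>

definition reduced_at ::
    "('n::finite, 'k::field) mpoly set \<Rightarrow> ('n \<Rightarrow>\<^sub>0 nat) set \<Rightarrow> ('n \<Rightarrow>\<^sub>0 nat) \<Rightarrow> ('n, 'k) mpoly \<Rightarrow> bool" where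
  "reduced_at I L m f \<longleftrightarrow> f \<in> I \<and> coeff f m = 1 \<and> supp f \<inter> L = {m}"

definition minimal_reduced ::
    "('n::finite, 'k::field) mpoly set \<Rightarrow> ('n \<Rightarrow>\<^sub>0 nat) set \<Rightarrow> ('n, 'k) mpoly set" where
  "minimal_reduced I L = {f. \<exists>m\<in>mono_min L. reduced_at I L m f}"

text \<open>
  Start from any monic element with leading exponent \<open>m\<close> and subtract, for each other exponent of it
  that lies in \<open>L\<close>, the element that the induction hypothesis provides there. Since these elements
  have only one exponent in \<open>L\<close> each, the corrections do not interfere, and one round of them suffices.
\<close>

lemma reduced_at_exists:
  fixes I :: "('n::finite, 'k::field) mpoly set"
  assumes I: "is_ideal I" and prec: "term_order prec" and "m \<in> lead_set prec I"
  shows "\<exists>f. reduced_at I (lead_set prec I) m f"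
  using term_order_wf[OF prec] assms(3)
proof (induction m rule: wfp_induct_rule)
  case (less m)
  let ?L = "lead_set prec I"
  obtain f where f: "f \<in> I" "f \<noteq> 0" "lead_exp prec f = m"
    using less.prems by (auto simp: lead_set_def)
  have m: "coeff f m \<noteq> 0" using lead_exp_max(1)[OF prec f(2)] f(3) by (simp add: in_keys_iff)
  define g where "g = Poly_Mapping.single 0 (inverse (coeff f m)) * f"
  have gI: "g \<in> I" unfolding g_def by (rule is_ideal_smult[OF I f(1)])
  have gm: "coeff g m = 1" using m by (simp add: g_def coeff_smult)
  \<comment> \<open>the exponents still to be removed\<close>
  define T where "T = supp g \<inter> ?L - {m}"
  have "\<exists>h. reduced_at I ?L k h" if "k \<in> T" for k
  proof (rule less.IH)
    have "k \<in> supp f" using that by (auto simp: T_def g_def in_keys_iff coeff_smult)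
    then show "prec (exponent k) (exponent m)"
      using lead_exp_max(2)[OF prec f(2)] f(3) that by (auto simp: T_def)
  qed (use that in \<open>auto simp: T_def\<close>)
  then obtain h where h: "\<And>k. k \<in> T \<Longrightarrow> reduced_at I ?L k (h k)" by metis
  define r where "r = g - (\<Sum>k\<in>T. Poly_Mapping.single 0 (coeff g k) * h k)"
  have rI: "r \<in> I"
    unfolding r_def using h
    by (intro is_ideal_diff[OF I gI] is_ideal_sum[OF I] is_ideal_smult[OF I]) (auto simp: reduced_at_def)
  have hl: "coeff (h k) l = (if k = l then 1 else 0)" if "l \<in> ?L" "k \<in> T" for k l
    using h[OF that(2)] that(1) unfolding reduced_at_def by (auto simp: in_keys_iff)
  have r: "coeff r l = coeff g l - (if l \<in> T then coeff g l else 0)" if "l \<in> ?L" for l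
  proof -
    have "(\<Sum>k\<in>T. coeff g k * coeff (h k) l) = (\<Sum>k\<in>T. if k = l then coeff g k else 0)"
      using hl[OF that] by (intro sum.cong) auto
    also have "\<dots> = (if l \<in> T then coeff g l else 0)" by (simp add: T_def sum.delta)
    finally show ?thesis by (simp add: r_def lookup_minus lookup_sum coeff_smult)
  qed
  have "coeff r m = 1" using r[OF less.prems] gm by (simp add: T_def)
  moreover have "l \<notin> supp r" if "l \<in> ?L" "l \<noteq> m" for l
    using r[OF that(1)] that by (auto simp: T_def in_keys_iff)
  ultimately have "reduced_at I ?L m r"
    using rI less.prems by (auto simp: reduced_at_def in_keys_iff)
  then show ?case ..
qed

text \<open>
  The difference of two candidates lies in \<open>I\<close> but has no exponent in \<open>L\<close>, where its leading
  exponent would have to be.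
\<close>

lemma reduced_at_unique:
  fixes I :: "('n::finite, 'k::field) mpoly set"
  assumes I: "is_ideal I" and prec: "term_order prec"
    and f: "reduced_at I (lead_set prec I) m f" and g: "reduced_at I (lead_set prec I) m g"
  shows "f = g"
proof (rule ccontr)
  assume "f \<noteq> g"
  moreover have "f - g \<in> I" using is_ideal_diff[OF I] f g by (simp add: reduced_at_def)
  ultimately obtain l where l: "l \<in> supp (f - g)" "l \<in> lead_set prec I"
    using lead_set_inter_supp[OF prec, of "f - g" I] by auto
  then have "l \<in> supp f \<or> l \<in> supp g" by (auto simp: in_keys_iff lookup_minus)
  then have "l = m" using f g l(2) unfolding reduced_at_def by blast
  then show False using l(1) f g by (simp add: reduced_at_def in_keys_iff lookup_minus)
qed

lemma reduced_at_lead: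
  fixes I :: "('n::finite, 'k::field) mpoly set"
  assumes prec: "term_order prec" and f: "reduced_at I (lead_set prec I) m f"
  shows "f \<noteq> 0" and "lead_exp prec f = m"
proof -
  show "f \<noteq> 0" using f by (auto simp: reduced_at_def)
  then show "lead_exp prec f = m"
    using lead_set_inter_supp[OF prec, of f I] f by (auto simp: reduced_at_def)
qed

lemma finite_minimal_reduced:
  fixes I :: "('n::finite, 'k::field) mpoly set"
  assumes I: "is_ideal I" and prec: "term_order prec"
  shows "finite (minimal_reduced I (lead_set prec I))"
proof (rule inj_on_finite)
  let ?G = "minimal_reduced I (lead_set prec I)"
  show "lead_exp prec ` ?G \<subseteq> mono_min (lead_set prec I)"
    using reduced_at_lead(2)[OF prec] by (auto simp: minimal_reduced_def)
  show "inj_on (lead_exp prec) ?G"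
  proof (rule inj_onI)
    fix f g assume fg: "f \<in> ?G" "g \<in> ?G" "lead_exp prec f = lead_exp prec g"
    then obtain a b where "reduced_at I (lead_set prec I) a f" "reduced_at I (lead_set prec I) b g"
      by (auto simp: minimal_reduced_def)
    then show "f = g"
      using reduced_at_lead(2)[OF prec, of I] fg(3) reduced_at_unique[OF I prec] by metis
  qed
qed (rule finite_mono_min)

lemma minimal_reduced_is_reduced_groebner_basis:
  fixes I :: "('n::finite, 'k::field) mpoly set"
  assumes I: "is_ideal I" and prec: "term_order prec"
  shows "is_reduced_groebner_basis prec I (minimal_reduced I (lead_set prec I))"
proof -
  let ?L = "lead_set prec I" and ?G = "minimal_reduced I (lead_set prec I)"
  have G: "\<exists>m\<in>mono_min ?L. reduced_at I ?L m f \<and> f \<noteq> 0 \<and> lead_exp prec f = m" if "f \<in> ?G" for f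
    using that reduced_at_lead[OF prec, of I _ f] by (auto simp: minimal_reduced_def)
  have "\<exists>g\<in>?G. lead_exp prec g \<sqsubseteq> k" if "k \<in> ?L" for k
  proof -
    obtain m where m: "m \<in> mono_min ?L" "m \<sqsubseteq> k" using mono_min_below[OF \<open>k \<in> ?L\<close>] .
    then obtain g where g: "reduced_at I ?L m g"
      using reduced_at_exists[OF I prec] by (auto simp: mono_min_def)
    then have "g \<in> ?G" using m(1) by (auto simp: minimal_reduced_def)
    then show ?thesis using m(2) reduced_at_lead(2)[OF prec g] by blast
  qed
  moreover have "?G \<subseteq> I - {0}" using G by (auto simp: minimal_reduced_def reduced_at_def)
  ultimately have gb: "groebner_basis prec I ?G"
    unfolding groebner_basis_iff[OF prec] using finite_minimal_reduced[OF I prec] by blast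
  have lc: "coeff g (lead_exp prec g) = 1" if "g \<in> ?G" for g
    using G[OF that] by (auto simp: reduced_at_def)
  have "\<not> initial_term prec g dvd Poly_Mapping.single k (coeff f k)"
    if fg: "f \<in> ?G" "g \<in> ?G - {f}" and k: "k \<in> supp f" for f g k
  proof
    obtain a where a: "a \<in> mono_min ?L" "reduced_at I ?L a f" using G[OF fg(1)] by blast
    obtain b where b: "b \<in> mono_min ?L" "reduced_at I ?L b g" "g \<noteq> 0" "lead_exp prec g = b"
      using G[of g] fg(2) by blast
    assume "initial_term prec g dvd Poly_Mapping.single k (coeff f k)"
    then have bk: "b \<sqsubseteq> k" using initial_term_dvd_iff[OF prec b(3)] k b(4) by (simp add: in_keys_iff)
    then have "k \<in> ?L"
      using mono_upset_lead_set[OF I prec] b(1) by (auto simp: mono_upset_def mono_min_def)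
    then have "k = a" using a(2) k by (auto simp: reduced_at_def)
    then have "b = a" using bk a(1) b(1) by (simp add: mono_min_def)
    then show False using reduced_at_unique[OF I prec a(2)] b(2) fg(2) by auto
  qed
  then show ?thesis unfolding is_reduced_groebner_basis_def using gb lc by blast
qed

text \<open>
  In a reduced basis \<open>H\<close>, an element whose leading exponent divides some exponent of \<open>f\<close> in \<open>H\<close> must be
  \<open>f\<close> itself. This forces \<open>f\<close> to meet \<open>L\<close> in its leading exponent only, and that exponent to be a
  minimal generator; and every minimal generator has to occur because \<open>H\<close> generates the initial ideal.
\<close>

lemma is_reduced_groebner_basis_unique:
  fixes I :: "('n::finite, 'k::field) mpoly set"
  assumes I: "is_ideal I" and prec: "term_order prec" and H: "is_reduced_groebner_basis prec I H"
  shows "H = minimal_reduced I (lead_set prec I)"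
proof -
  let ?L = "lead_set prec I" and ?G = "minimal_reduced I (lead_set prec I)"
  have HI: "H \<subseteq> I - {0}"
    using H unfolding is_reduced_groebner_basis_def groebner_basis_iff[OF prec] by simp
  have cover: "\<exists>g\<in>H. lead_exp prec g \<sqsubseteq> m" if "m \<in> ?L" for m
    using H that unfolding is_reduced_groebner_basis_def groebner_basis_iff[OF prec] by simp
  have lc: "coeff g (lead_exp prec g) = 1" if "g \<in> H" for g
    using H that unfolding is_reduced_groebner_basis_def by simp
  have red: "\<not> initial_term prec g dvd Poly_Mapping.single k (coeff f k)"
    if "f \<in> H" "g \<in> H - {f}" "k \<in> supp f" for f g k
    using H that unfolding is_reduced_groebner_basis_def by simp
  have div: "g = f" if fg: "f \<in> H" "g \<in> H" "k \<in> supp f" "lead_exp prec g \<sqsubseteq> k" for f g k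
  proof (rule ccontr)
    assume "g \<noteq> f"
    then show False
      using red[of f g k] fg HI initial_term_dvd_iff[OF prec, of g "coeff f k" k]
      by (auto simp: in_keys_iff)
  qed
  have HG: "H \<subseteq> ?G"
  proof
    fix f assume f: "f \<in> H"
    define m where "m = lead_exp prec f"
    have f0: "f \<in> I" "f \<noteq> 0" using f HI by auto
    have m: "m \<in> supp f" "m \<in> ?L" using lead_set_inter_supp[OF prec f0] by (auto simp: m_def)
    have uniq: "k = m" if k: "k \<in> supp f" "k \<in> ?L" for k
    proof (rule ccontr)
      assume "k \<noteq> m"
      obtain g where "g \<in> H" "lead_exp prec g \<sqsubseteq> k" using cover[OF k(2)] by blast
      then have "m \<sqsubseteq> k" using div[OF f _ k(1)] by (auto simp: m_def)
      then have "prec (exponent m) (exponent k)"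
        using term_order_mono_dvd[OF prec] \<open>k \<noteq> m\<close> by blast
      moreover have "prec (exponent k) (exponent m)"
        using lead_exp_max(2)[OF prec f0(2) k(1)] \<open>k \<noteq> m\<close> by (simp add: m_def)
      ultimately show False using term_order_trans[OF prec] term_order_irrefl[OF prec] by blast
    qed
    have least: "l = m" if l: "l \<in> ?L" "l \<sqsubseteq> m" for l
    proof -
      obtain g where g: "g \<in> H" "lead_exp prec g \<sqsubseteq> l" using cover[OF l(1)] by blast
      then have "g = f" using div[OF f g(1) m(1)] l(2) mono_dvd_trans by blast
      then show ?thesis using g(2) l(2) mono_dvd_antisym by (simp add: m_def)
    qed
    have "supp f \<inter> ?L = {m}" using m uniq by blast
    then have "reduced_at I ?L m f" using f0(1) lc[OF f] by (simp add: reduced_at_def m_def)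
    moreover have "m \<in> mono_min ?L" using m(2) least by (simp add: mono_min_def)
    ultimately show "f \<in> ?G" by (auto simp: minimal_reduced_def)
  qed
  moreover have "f \<in> H" if fG: "f \<in> ?G" for f
  proof -
    obtain m where m: "m \<in> mono_min ?L" "reduced_at I ?L m f"
      using fG by (auto simp: minimal_reduced_def)
    then obtain g where g: "g \<in> H" "lead_exp prec g \<sqsubseteq> m" using cover by (auto simp: mono_min_def)
    then obtain k where k: "k \<in> mono_min ?L" "reduced_at I ?L k g"
      using HG by (auto simp: minimal_reduced_def)
    then have "k = m"
      using g(2) m(1) reduced_at_lead(2)[OF prec k(2)] by (simp add: mono_min_def)
    then show ?thesis using reduced_at_unique[OF I prec m(2)] k(2) g(1) by simp
  qed
  ultimately show ?thesis by blast
qed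

text \<open>
  The reduced Gr\<ouml>bner basis depends on the order only through the initial ideal. Hence finitely many
  initial ideals give finitely many reduced Gr\<ouml>bner bases.
\<close>

lemma reduced_groebner_basis_eq:
  fixes I :: "('n::finite, 'k::field) mpoly set"
  assumes "is_ideal I" "term_order prec"
  shows "reduced_groebner_basis prec I = minimal_reduced I (lead_set prec I)"
  unfolding reduced_groebner_basis_def
  using minimal_reduced_is_reduced_groebner_basis[OF assms] is_reduced_groebner_basis_unique[OF assms]
  by (rule the_equality)

section \<open>Finiteness of the Gr\<ouml>bner fan\<close>

text \<open>
  Noetherian induction over monomial ideals \<open>M\<close>, showing that only finitely many initial ideals
  contain \<open>M\<close>. If one of them is strictly larger, it has a monomial outside \<open>M\<close>, and reducing that
  monomial gives \<open>f\<close> in \<open>I\<close> without any monomial in \<open>M\<close>. Every initial ideal contains one of the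
  finitely many monomials of \<open>f\<close>, namely the leading one; so every initial ideal above \<open>M\<close> lies above
  one of finitely many strictly larger monomial ideals.
\<close>

lemma finite_lead_sets:
  fixes I :: "('n::finite, 'k::field) mpoly set"
  assumes I: "is_ideal I"
  shows "finite {lead_set prec I | prec. term_order prec}" (is "finite ?\<Lambda>")
proof -
  have "mono_upset M \<longrightarrow> finite {L \<in> ?\<Lambda>. M \<subseteq> L}" for M
    using wf_mono_upset
  proof (induction M rule: wf_induct_rule)
    case (less M)
    show ?case
    proof
      assume M: "mono_upset M"
      show "finite {L \<in> ?\<Lambda>. M \<subseteq> L}"
      proof (cases "{L \<in> ?\<Lambda>. M \<subseteq> L} \<subseteq> {M}")
        case True
        then show ?thesis using finite_subset by blast
      next
        case False
        then obtain prec m where prec: "term_order prec" "M \<subseteq> lead_set prec I"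
          and m: "m \<in> lead_set prec I" "m \<notin> M" by blast
        obtain f where f: "reduced_at I (lead_set prec I) m f"
          using reduced_at_exists[OF I prec(1) m(1)] by blast
        have disj: "supp f \<inter> M = {}" using f prec(2) m(2) by (auto simp: reduced_at_def)
        have "{L \<in> ?\<Lambda>. M \<subseteq> L} \<subseteq> (\<Union>k\<in>supp f. {L \<in> ?\<Lambda>. M \<union> {l. k \<sqsubseteq> l} \<subseteq> L})"
        proof
          fix L assume L: "L \<in> {L \<in> ?\<Lambda>. M \<subseteq> L}"
          then obtain prec' where p': "term_order prec'" "L = lead_set prec' I" by blast
          have "lead_exp prec' f \<in> supp f" "lead_exp prec' f \<in> L"
            using lead_set_inter_supp[OF p'(1), of f I] p'(2) f reduced_at_lead(1)[OF prec(1) f]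
            by (auto simp: reduced_at_def)
          moreover from this have "{l. lead_exp prec' f \<sqsubseteq> l} \<subseteq> L"
            using mono_upset_lead_set[OF I p'(1)] p'(2) unfolding mono_upset_def by blast
          ultimately show "L \<in> (\<Union>k\<in>supp f. {L \<in> ?\<Lambda>. M \<union> {l. k \<sqsubseteq> l} \<subseteq> L})"
            using L by (intro UN_I[of "lead_exp prec' f"]) simp_all
        qed
        moreover have "finite {L \<in> ?\<Lambda>. M \<union> {l. k \<sqsubseteq> l} \<subseteq> L}" if "k \<in> supp f" for k
        proof -
          have "mono_upset (M \<union> {l. k \<sqsubseteq> l})"
            using M mono_dvd_trans unfolding mono_upset_def by blast
          moreover have "M \<subset> M \<union> {l. k \<sqsubseteq> l}" using disj that by (auto simp: psubset_eq)
          ultimately show ?thesis using less.IH[of "M \<union> {l. k \<sqsubseteq> l}"] M by simp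
        qed
        ultimately show ?thesis by (meson finite_UN_I finite_keys finite_subset)
      qed
    qed
  qed
  from this[of "{}"] show ?thesis by (simp add: mono_upset_def)
qed

text \<open>
  The normals of all hyperplanes that bound Gr\<ouml>bner cones, apart from the coordinate hyperplanes.
\<close>

definition fan_diffs :: "('n::finite, 'k::field) mpoly set \<Rightarrow> (int ^ 'n) set" where
  "fan_diffs I =
     (\<Union>prec\<in>{prec. term_order prec}. \<Union>f\<in>reduced_groebner_basis prec I. lead_diffs prec f)"

lemma finite_fan_diffs:
  fixes I :: "('n::finite, 'k::field) mpoly set"
  assumes I: "is_ideal I"
  shows "finite (fan_diffs I)"
proof (rule finite_subset)
  let ?B = "\<Union>L\<in>{lead_set prec I | prec. term_order prec}. minimal_reduced I L"
  let ?D = "\<Union>f\<in>?B. (\<lambda>(a, b). exponent a - exponent b) ` (supp f \<times> supp f)"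
  show "finite ?D" using finite_lead_sets[OF I] finite_minimal_reduced[OF I] by auto
  show "fan_diffs I \<subseteq> ?D"
  proof
    fix v assume "v \<in> fan_diffs I"
    then obtain prec f where p: "term_order prec" "f \<in> reduced_groebner_basis prec I" "v \<in> lead_diffs prec f"
      by (auto simp: fan_diffs_def)
    then have fB: "f \<in> minimal_reduced I (lead_set prec I)"
      using reduced_groebner_basis_eq[OF I] by blast
    then have "f \<noteq> 0" by (auto simp: minimal_reduced_def reduced_at_def)
    then have "lead_exp prec f \<in> supp f" using lead_exp_max(1)[OF p(1)] by blast
    then have "v \<in> (\<lambda>(a, b). exponent a - exponent b) ` (supp f \<times> supp f)"
      using p(3) by (auto simp: lead_diffs_def)
    then show "v \<in> ?D" using fB p(1) by blast
  qed
qed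

lemma lead_diffs_pos:
  fixes I :: "('n::finite, 'k::field) mpoly set"
  assumes I: "is_ideal I" and prec: "term_order prec"
    and "f \<in> reduced_groebner_basis prec I" and v: "v \<in> lead_diffs prec f"
  shows "prec 0 v"
proof -
  have "f \<noteq> 0"
    using assms(3) unfolding reduced_groebner_basis_eq[OF I prec]
    by (auto simp: minimal_reduced_def reduced_at_def)
  then show ?thesis
    using v lead_exp_max(2)[OF prec, of f] term_order_pos_iff[OF prec] by (auto simp: lead_diffs_def)
qed


section \<open>Polyhedral cones near a point lying on at most one wall\<close>

text \<open>
  Close to \<open>p\<close>, only the normals orthogonal to \<open>p\<close> matter for membership in the cone; the set
  \<open>strict\<close> below is a neighbourhood of \<open>p\<close> on which all
  the others stay strictly positive.
\<close>

locale cone_point =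
  fixes A C :: "(real ^ 'n) set" and p :: "real ^ 'n"
  assumes finite_normals: "finite A" and normals_nz: "0 \<notin> A"
    and cone_eq: "C = {w. \<forall>a\<in>A. 0 \<le> a \<bullet> w}"
    and mem_cone: "p \<in> C"
begin

definition strict :: "(real ^ 'n) set" where
  "strict = {w. \<forall>a\<in>A. 0 < a \<bullet> p \<longrightarrow> 0 < a \<bullet> w}"

lemma open_strict: "open strict"
proof -
  have "strict = (\<Inter>a\<in>{a \<in> A. 0 < a \<bullet> p}. {w. a \<bullet> w > 0})" by (auto simp: strict_def)
  then show ?thesis using finite_normals by (simp add: open_INT open_halfspace_gt)
qed

lemma mem_strict: "p \<in> strict"
  by (simp add: strict_def)

lemma zero_or_pos: "a \<in> A \<Longrightarrow> a \<bullet> p = 0 \<or> 0 < a \<bullet> p"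
  using mem_cone by (auto simp: cone_eq order_less_le)

lemma mem_interior_if_off_walls:
  assumes "\<And>a. a \<in> A \<Longrightarrow> a \<bullet> p \<noteq> 0"
  shows "p \<in> interior C"
proof (rule interiorI[OF open_strict mem_strict])
  show "strict \<subseteq> C" using assms zero_or_pos by (auto simp: strict_def cone_eq intro: less_imp_le)
qed

lemma eventually_strict: "\<forall>\<^sub>F s in at_right (0 :: real). 0 < s \<and> p + s *\<^sub>R u \<in> strict"
proof -
  have "((\<lambda>s. p + s *\<^sub>R u) \<longlongrightarrow> p + 0 *\<^sub>R u) (at_right 0)" by (intro tendsto_intros)
  then have "\<forall>\<^sub>F s in at_right 0. p + s *\<^sub>R u \<in> strict"
    using open_strict mem_strict by (simp add: topological_tendstoD)
  then show ?thesis by (intro eventually_conj eventually_at_right_less)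
qed

lemma strict_step:
  obtains s where "0 < s" "p + s *\<^sub>R u \<in> strict"
  using eventually_happens[OF eventually_strict] by auto

end

text \<open>
  All normals orthogonal to \<open>p\<close> are positive multiples of \<open>v\<close>, so near \<open>p\<close> the cone is a half-space.
  The positivity matters: with a negative multiple among them, the cone would lie in the hyperplane
  orthogonal to \<open>v\<close>.
\<close>

locale wall_point = cone_point A C p for A C :: "(real ^ 'n) set" and p +
  fixes v :: "real ^ 'n"
  assumes normal: "v \<in> A" and orthogonal: "v \<bullet> p = 0"
    and only_wall: "\<And>a. a \<in> A \<Longrightarrow> a \<bullet> p = 0 \<Longrightarrow> \<exists>c>0. a = c *\<^sub>R v"
begin

definition wall :: "(real ^ 'n) set" where
  "wall = {c \<in> C. v \<bullet> c = 0}"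

lemma normal_nz: "v \<noteq> 0"
  using normal normals_nz by auto

lemma strict_mem_cone_iff: "w \<in> strict \<Longrightarrow> w \<in> C \<longleftrightarrow> 0 \<le> v \<bullet> w"
proof
  assume w: "w \<in> strict" "0 \<le> v \<bullet> w"
  have "0 \<le> a \<bullet> w" if a: "a \<in> A" for a
  proof (cases "a \<bullet> p = 0")
    case True
    then obtain c where "c > 0" "a = c *\<^sub>R v" using only_wall a by blast
    then show ?thesis using w(2) by simp
  next
    case False
    then show ?thesis using w(1) zero_or_pos[OF a] a by (auto simp: strict_def intro: less_imp_le)
  qed
  then show "w \<in> C" by (simp add: cone_eq)
qed (use normal in \<open>simp add: cone_eq\<close>)

lemma strict_Int_wall: "strict \<inter> wall = strict \<inter> {w. v \<bullet> w = 0}"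
  using strict_mem_cone_iff by (auto simp: wall_def)

lemma dim_wall: "dim wall = CARD('n) - 1"
proof (rule antisym)
  show "dim wall \<le> CARD('n) - 1"
    using dim_subset[of wall "{w. v \<bullet> w = 0}"] dim_hyperplane[OF normal_nz] by (auto simp: wall_def)
  have "openin (top_of_set {w. v \<bullet> w = 0}) (strict \<inter> {w. v \<bullet> w = 0})"
    using openin_open_Int[OF open_strict] by (subst Int_commute)
  then have "dim (strict \<inter> {w. v \<bullet> w = 0}) = dim {w. v \<bullet> w = 0}"
    using mem_strict orthogonal by (intro dim_openin) (auto simp: subspace_hyperplane)
  then show "CARD('n) - 1 \<le> dim wall"
    using dim_subset[of "strict \<inter> wall" wall] dim_hyperplane[OF normal_nz] strict_Int_wall by auto
qed

lemma dim_cone: "dim C = CARD('n)"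
proof -
  let ?U = "strict \<inter> {w. v \<bullet> w > 0}"
  obtain s where s: "0 < s" "p + s *\<^sub>R v \<in> strict" using strict_step .
  have "v \<bullet> (p + s *\<^sub>R v) > 0" using s(1) orthogonal normal_nz by (simp add: inner_add_right)
  then have "?U \<noteq> {}" using s(2) by blast
  moreover have "open ?U" using open_strict by (simp add: open_Int open_halfspace_gt)
  ultimately have "dim ?U = CARD('n)" using dim_openin[of UNIV ?U] by simp
  moreover have "?U \<subseteq> C" using strict_mem_cone_iff by auto
  ultimately show ?thesis using dim_subset[of ?U C] dim_subset_UNIV[of C] by simp
qed

lemma mem_wall: "p \<in> wall"
  using mem_cone orthogonal by (simp add: wall_def)

lemma wall_facet: "cone_facet wall C"
proof -
  have "cone_face wall C"
    unfolding cone_face_def wall_def using normal by (intro exI[of _ v]) (auto simp: cone_eq)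
  then show ?thesis by (simp add: cone_facet_def dim_wall dim_cone)
qed

lemma mem_rel_interior_wall: "p \<in> rel_interior wall"
proof -
  have "affine hull wall \<subseteq> {w. v \<bullet> w = 0}"
    by (intro hull_minimal) (auto simp: wall_def affine_hyperplane)
  then have "strict \<inter> affine hull wall \<subseteq> wall" using strict_Int_wall by blast
  then show ?thesis unfolding mem_rel_interior using open_strict mem_strict mem_wall by blast
qed

text \<open>
  A linear form that is nonnegative on \<open>C\<close> and vanishes at a relatively interior point of the wall
  vanishes on the whole wall: from any \<open>c\<close> in the wall, one can walk slightly beyond \<open>p\<close> without
  leaving \<open>C\<close>.
\<close>

lemma wall_minimal_face:
  assumes "cone_face F C" "p \<in> F"
  shows "wall \<subseteq> F"
proof
  fix c assume c: "c \<in> wall"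
  obtain u where u: "\<And>c. c \<in> C \<Longrightarrow> 0 \<le> u \<bullet> c" and F: "F = {c \<in> C. u \<bullet> c = 0}"
    using assms(1) unfolding cone_face_def by blast
  \<comment> \<open>a point of the wall beyond \<open>p\<close>, seen from \<open>c\<close>\<close>
  obtain s where s: "0 < s" "p + s *\<^sub>R (p - c) \<in> strict" using strict_step .
  have "v \<bullet> (p + s *\<^sub>R (p - c)) = 0"
    using c orthogonal by (simp add: wall_def inner_add_right inner_diff_right)
  then have "0 \<le> u \<bullet> (p + s *\<^sub>R (p - c))" using u strict_mem_cone_iff[OF s(2)] by simp
  then have "u \<bullet> c \<le> 0"
    using assms(2) s(1) by (simp add: F inner_add_right inner_diff_right mult_le_0_iff)
  then show "c \<in> F" using u[of c] c by (simp add: F wall_def)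
qed

end

lemma face_through_interior:
  assumes "cone_face F C" "p \<in> F" "p \<in> interior C"
  shows "F = C"
proof -
  obtain u where u: "\<And>c. c \<in> C \<Longrightarrow> 0 \<le> u \<bullet> c" and F: "F = {c \<in> C. u \<bullet> c = 0}"
    using assms(1) unfolding cone_face_def by blast
  have "((\<lambda>s. p - s *\<^sub>R u) \<longlongrightarrow> p - 0 *\<^sub>R u) (at_right (0::real))" by (intro tendsto_intros)
  then have "\<forall>\<^sub>F s in at_right (0::real). p - s *\<^sub>R u \<in> interior C"
    using assms(3) by (simp add: topological_tendstoD)
  then have "\<forall>\<^sub>F s in at_right (0::real). 0 < s \<and> p - s *\<^sub>R u \<in> interior C"
    by (intro eventually_conj eventually_at_right_less)
  then obtain s :: real where s: "0 < s" "p - s *\<^sub>R u \<in> interior C"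
    using eventually_happens by force
  then have "0 \<le> u \<bullet> (p - s *\<^sub>R u)" using u interior_subset by blast
  then have "s * (u \<bullet> u) \<le> 0" using assms(2) by (simp add: F inner_diff_right)
  then have "u = 0" using s(1) inner_ge_zero[of u] by (auto simp: mult_le_0_iff)
  then show ?thesis by (simp add: F)
qed

section \<open>Gr\<ouml>bner cones\<close>

definition cone_normals ::
    "(int ^ 'n \<Rightarrow> int ^ 'n \<Rightarrow> bool) \<Rightarrow> ('n::finite, 'k::field) mpoly set \<Rightarrow> (int ^ 'n) set" where
  "cone_normals prec I =
     range (\<lambda>i. axis i 1) \<union> (\<Union>f\<in>reduced_groebner_basis prec I. lead_diffs prec f)"

lemma int_vec_axis: "int_vec (axis i 1) = axis i 1"
  by (simp add: int_vec_def axis_def vec_eq_iff)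

lemma int_vec_eq_0_iff: "int_vec v = 0 \<longleftrightarrow> v = 0"
  by (simp add: int_vec_def vec_eq_iff)

lemma groebner_cone_eq:
  fixes I :: "('n::finite, 'k::field) mpoly set"
  shows "groebner_cone prec I = {w. \<forall>a\<in>int_vec ` cone_normals prec I. 0 \<le> a \<bullet> w}"
proof -
  have "0 \<le> int_vec (axis i 1) \<bullet> w \<longleftrightarrow> 0 \<le> w $ i" for i and w :: "real ^ 'n"
    by (simp add: int_vec_axis inner_axis')
  moreover have "int_vec v \<bullet> w = w \<bullet> int_vec v" for v and w :: "real ^ 'n"
    by (rule inner_commute)
  ultimately show ?thesis by (simp add: groebner_cone_def cone_normals_def ball_Un)
qed

lemma cone_normals_pos:
  fixes I :: "('n::finite, 'k::field) mpoly set"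
  assumes "is_ideal I" "term_order prec" "v \<in> cone_normals prec I"
  shows "prec 0 v"
  using assms lead_diffs_pos[OF assms(1,2)] by (auto simp: cone_normals_def term_order_def)

lemma finite_cone_normals:
  fixes I :: "('n::finite, 'k::field) mpoly set"
  assumes "is_ideal I" "term_order prec"
  shows "finite (cone_normals prec I)"
proof -
  have "(\<Union>f\<in>reduced_groebner_basis prec I. lead_diffs prec f) \<subseteq> fan_diffs I"
    using assms(2) by (auto simp: fan_diffs_def)
  then show ?thesis
    using finite_fan_diffs[OF assms(1)] finite_subset by (auto simp: cone_normals_def)
qed

lemma cone_point_groebner_cone:
  fixes I :: "('n::finite, 'k::field) mpoly set"
  assumes "is_ideal I" "term_order prec" "p \<in> groebner_cone prec I"
  shows "cone_point (int_vec ` cone_normals prec I) (groebner_cone prec I) p"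
proof
  show "0 \<notin> int_vec ` cone_normals prec I"
    using cone_normals_pos[OF assms(1,2)] term_order_irrefl[OF assms(2)] int_vec_eq_0_iff
    by (metis imageE)
qed (use finite_cone_normals[OF assms(1,2)] assms(3) groebner_cone_eq in auto)

lemma term_order_scale:
  assumes prec: "term_order prec" "prec 0 v" and "0 < n"
  shows "prec 0 (int n *s v)"
  using assms(3)
proof (induction n)
  case (Suc n)
  have "int (Suc n) *s v = int n *s v + v" by (simp add: vec_eq_iff algebra_simps)
  moreover have "int n *s v = 0 \<or> prec 0 (int n *s v)" using Suc by (cases n) auto
  ultimately show ?case
    using prec(2) term_order_add_pos[OF prec(1)] by auto
qed simp

text \<open>
  If \<open>c\<close> were negative, scaling by the absolute values of two corresponding coordinates would give
  positive integers \<open>a\<close>, \<open>b\<close> with $a w + b v = 0$, although both summands are positive in the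
  order.
\<close>

lemma positive_parallel:
  fixes v w :: "int ^ 'n"
  assumes prec: "term_order prec" and v: "prec 0 v" and w: "prec 0 w"
    and c: "int_vec w = c *\<^sub>R int_vec v"
  shows "0 < c"
proof (rule ccontr)
  assume "\<not> 0 < c"
  have "w \<noteq> 0" using w term_order_irrefl[OF prec] by auto
  have wv: "real_of_int (w $ j) = c * real_of_int (v $ j)" for j
    using c by (simp add: int_vec_def vec_eq_iff)
  obtain i where i: "w $ i \<noteq> 0" using \<open>w \<noteq> 0\<close> by (auto simp: vec_eq_iff)
  have "c < 0" using \<open>\<not> 0 < c\<close> wv[of i] i by (cases "c = 0") auto
  let ?a = "\<bar>v $ i\<bar>" and ?b = "\<bar>w $ i\<bar>"
  have "?b * v $ j + ?a * w $ j = 0" for j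
  proof -
    have "\<bar>real_of_int (w $ i)\<bar> = - c * \<bar>real_of_int (v $ i)\<bar>"
      using wv[of i] \<open>c < 0\<close> by (simp add: abs_mult)
    then have "real_of_int (?b * v $ j + ?a * w $ j) = 0" using wv[of j] by simp
    then show ?thesis by linarith
  qed
  then have sum0: "?b *s v + ?a *s w = 0" by (simp add: vec_eq_iff)
  have "v $ i \<noteq> 0" using wv[of i] i by auto
  then have "prec 0 (?a *s w)" "prec 0 (?b *s v)"
    using term_order_scale[OF prec w, of "nat ?a"] term_order_scale[OF prec v, of "nat ?b"] i by auto
  then have "prec 0 (?b *s v + ?a *s w)"
    by (intro term_order_add_pos[OF prec])
  then show False using sum0 term_order_irrefl[OF prec] by simp
qed

text \<open>
  The point lies on at most one of the hyperplanes bounding Gr\<ouml>bner cones. Different normals may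
  define the same hyperplane, so the condition speaks of parallel vectors.
\<close>

definition generic :: "('n::finite, 'k::field) mpoly set \<Rightarrow> real ^ 'n \<Rightarrow> bool" where
  "generic I p \<longleftrightarrow> (\<forall>i. 0 < p $ i) \<and>
     (\<forall>v\<in>fan_diffs I. \<forall>w\<in>fan_diffs I. int_vec v \<bullet> p = 0 \<and> int_vec w \<bullet> p = 0 \<longrightarrow>
        (\<exists>c. int_vec w = c *\<^sub>R int_vec v))"

lemma generic_cases:
  fixes I :: "('n::finite, 'k::field) mpoly set"
  assumes I: "is_ideal I" and prec: "term_order prec" and p: "generic I p"
    and pC: "p \<in> groebner_cone prec I"
  shows "p \<in> interior (groebner_cone prec I) \<or>
    (\<exists>F. cone_facet F (groebner_cone prec I) \<and> dim F = CARD('n) - 1 \<and> p \<in> rel_interior F \<and>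
       (\<forall>F'. cone_face F' (groebner_cone prec I) \<and> p \<in> F' \<longrightarrow> F \<subseteq> F'))"
proof (cases "\<exists>v\<in>cone_normals prec I. int_vec v \<bullet> p = 0")
  case False
  then show ?thesis
    using cone_point.mem_interior_if_off_walls[OF cone_point_groebner_cone[OF I prec pC]] by blast
next
  case True
  then obtain v where v: "v \<in> cone_normals prec I" "int_vec v \<bullet> p = 0" by blast
  have diffs: "a \<in> fan_diffs I" if a: "a \<in> cone_normals prec I" "int_vec a \<bullet> p = 0" for a
  proof -
    \<comment> \<open>coordinate hyperplanes do not meet the open orthant, so the normal comes from the ideal\<close>
    have "a \<noteq> axis i 1" for i
      using a(2) p by (auto simp: generic_def int_vec_axis inner_axis' less_le)
    then show ?thesis using a(1) prec by (auto simp: cone_normals_def fan_diffs_def)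
  qed
  have "\<exists>c>0. a = c *\<^sub>R int_vec v" if a: "a \<in> int_vec ` cone_normals prec I" "a \<bullet> p = 0" for a
  proof -
    obtain w where w: "w \<in> cone_normals prec I" "a = int_vec w" using a(1) by blast
    then obtain c where "a = c *\<^sub>R int_vec v"
      using p diffs[OF v] diffs[of w] v(2) a(2) unfolding generic_def by blast
    moreover from this have "0 < c"
      using positive_parallel[OF prec cone_normals_pos[OF I prec v(1)] cone_normals_pos[OF I prec w(1)]] w(2)
      by simp
    ultimately show ?thesis by blast
  qed
  then interpret wall_point "int_vec ` cone_normals prec I" "groebner_cone prec I" p "int_vec v"
    using cone_point_groebner_cone[OF I prec pC] v
    by (intro wall_point.intro wall_point_axioms.intro) auto
  show ?thesis using wall_facet dim_wall mem_rel_interior_wall wall_minimal_face by blast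
qed

definition refine_order ::
    "real ^ 'n \<Rightarrow> (int ^ 'n \<Rightarrow> int ^ 'n \<Rightarrow> bool) \<Rightarrow> int ^ 'n \<Rightarrow> int ^ 'n \<Rightarrow> bool" where
  "refine_order p prec u v \<longleftrightarrow>
     p \<bullet> int_vec u < p \<bullet> int_vec v \<or> p \<bullet> int_vec u = p \<bullet> int_vec v \<and> prec u v"

lemma int_vec_add: "int_vec (u + v) = int_vec u + int_vec v"
  by (simp add: int_vec_def vec_eq_iff)

lemma int_vec_0 [simp]: "int_vec 0 = 0"
  by (simp add: int_vec_def vec_eq_iff)

lemma term_order_refine_order:
  assumes prec: "term_order prec" and "\<And>i. 0 \<le> p $ i"
  shows "term_order (refine_order p prec)"
  unfolding term_order_def group_order_def
proof (intro conjI allI impI)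
  show "irreflp (refine_order p prec)"
    using term_order_irrefl[OF prec] by (auto intro!: irreflpI simp: refine_order_def)
  show "transp (refine_order p prec)"
    using term_order_trans[OF prec] by (intro transpI) (fastforce simp: refine_order_def)
  show "totalp (refine_order p prec)"
    using term_order_total[OF prec] by (intro totalpI) (fastforce simp: refine_order_def)
  show "refine_order p prec (u + w) (v + w)" if "refine_order p prec u v" for u v w
    using that term_order_translate[OF prec, of u v w]
    by (auto simp: refine_order_def int_vec_add inner_add_right)
  show "refine_order p prec 0 (axis i 1)" for i
    using assms(2)[of i] prec
    by (auto simp: refine_order_def int_vec_axis inner_axis term_order_def)
qed

text \<open>
  The Gr\<ouml>bner cones cover the nonnegative orthant: positivity of a normal with respect to the
  refined order entails that its product with \<open>p\<close> is nonnegative.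
\<close>

lemma mem_groebner_cone_refine_order:
  fixes I :: "('n::finite, 'k::field) mpoly set"
  assumes "is_ideal I" "term_order prec" "\<And>i. 0 \<le> p $ i"
  shows "p \<in> groebner_cone (refine_order p prec) I"
  using cone_normals_pos[OF assms(1) term_order_refine_order[OF assms(2,3)]]
  by (fastforce simp: groebner_cone_eq refine_order_def inner_commute)

lemma generic_in_fan_cone:
  fixes I :: "('n::finite, 'k::field) mpoly set" and prec :: "int ^ 'n \<Rightarrow> int ^ 'n \<Rightarrow> bool"
  assumes I: "is_ideal I" and prec: "term_order prec" and p: "generic I p"
  shows "\<exists>F\<in>groebner_fan I. (dim F = CARD('n) \<or> dim F = CARD('n) - 1) \<and> p \<in> rel_interior F"
proof -
  let ?prec = "refine_order p prec"
  let ?C = "groebner_cone ?prec I"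
  have nonneg: "\<And>i. 0 \<le> p $ i" using p by (auto simp: generic_def less_imp_le)
  have rp: "term_order ?prec" by (rule term_order_refine_order[OF prec nonneg])
  have "p \<in> ?C" by (rule mem_groebner_cone_refine_order[OF I prec nonneg])
  from generic_cases[OF I rp p this]
  consider "p \<in> interior ?C" |
    F where "cone_facet F ?C" "dim F = CARD('n) - 1" "p \<in> rel_interior F" by blast
  then show ?thesis
  proof cases
    case 1
    have "dim (interior ?C) = CARD('n)" using dim_openin[of UNIV "interior ?C"] 1 by auto
    then have "dim ?C = CARD('n)"
      using dim_subset[OF interior_subset[of ?C]] dim_subset_UNIV[of ?C] by simp
    moreover have "?C \<in> groebner_fan I" using rp by (auto simp: groebner_fan_def)
    moreover have "p \<in> rel_interior ?C" using 1 interior_subset_rel_interior by blast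
    ultimately show ?thesis by blast
  next
    case 2
    then have "F \<in> groebner_fan I" using rp by (auto simp: groebner_fan_def cone_facet_def)
    then show ?thesis using 2 by blast
  qed
qed

lemma generic_smallest_face:
  fixes I :: "('n::finite, 'k::field) mpoly set"
  assumes I: "is_ideal I" and prec: "term_order prec" and p: "generic I p"
    and F: "cone_face F (groebner_cone prec I)" "F \<noteq> groebner_cone prec I" "p \<in> F"
  shows "\<exists>F'. cone_facet F' (groebner_cone prec I) \<and> p \<in> F' \<and>
    (\<forall>F''. cone_face F'' (groebner_cone prec I) \<and> p \<in> F'' \<longrightarrow> F' \<subseteq> F'')"
proof -
  have "p \<in> groebner_cone prec I" using F by (auto simp: cone_face_def)
  moreover have "p \<notin> interior (groebner_cone prec I)" using face_through_interior F by blast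
  ultimately show ?thesis using generic_cases[OF I prec p] rel_interior_subset by blast
qed

section \<open>Perturbed weight vectors\<close>

definition perturb :: "(nat \<Rightarrow> rat ^ 'n) \<Rightarrow> real \<Rightarrow> real ^ 'n" where
  "perturb \<omega> \<eta> = (\<Sum>i<CARD('n). \<eta> ^ i *\<^sub>R rat_vec (\<omega> i))"

lemma rat_vec_perturbed: "rat_vec (perturbed \<omega> \<eta>) = perturb \<omega> (real_of_rat \<eta>)"
  by (simp add: rat_vec_def perturbed_def perturb_def vec_eq_iff of_rat_sum of_rat_mult of_rat_power)

text \<open>
  For small argument, the lowest nonzero coefficient decides the sign of a polynomial: after factoring
  out the power belonging to it, the rest converges to that coefficient.
\<close>

lemma eventually_sum_powers_pos:
  fixes a :: "nat \<Rightarrow> real"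
  assumes "k < n" "0 < a k" "\<And>j. j < k \<Longrightarrow> a j = 0"
  shows "\<forall>\<^sub>F \<eta> in at_right 0. 0 < (\<Sum>i<n. \<eta> ^ i * a i)"
proof -
  have "((\<lambda>\<eta>. \<Sum>i=k..<n. \<eta> ^ (i - k) * a i) \<longlongrightarrow> (\<Sum>i=k..<n. 0 ^ (i - k) * a i)) (at_right (0::real))"
    by (intro tendsto_intros)
  moreover have "(\<Sum>i=k..<n. 0 ^ (i - k) * a i) = (\<Sum>i=k..<n. if i = k then a i else 0)"
    by (intro sum.cong) (auto simp: power_0_left)
  moreover have "\<dots> = a k" using assms(1) by (simp add: sum.delta)
  ultimately have "\<forall>\<^sub>F \<eta> in at_right 0. 0 < (\<Sum>i=k..<n. \<eta> ^ (i - k) * a i)"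
    using assms(2) by (auto dest: order_tendstoD)
  then show ?thesis using eventually_at_right_less[of "0::real"]
  proof eventually_elim
    case (elim \<eta>)
    have "(\<Sum>i<n. \<eta> ^ i * a i) = (\<Sum>i=k..<n. \<eta> ^ i * a i)"
      using assms(3) by (intro sum.mono_neutral_right) auto
    also have "\<dots> = \<eta> ^ k * (\<Sum>i=k..<n. \<eta> ^ (i - k) * a i)"
      unfolding sum_distrib_left by (intro sum.cong) (auto simp: power_add[symmetric])
    finally show ?case using elim by simp
  qed
qed

lemma inner_perturb: "perturb \<omega> \<eta> \<bullet> x = (\<Sum>i<CARD('n). \<eta> ^ i * (rat_vec (\<omega> i) \<bullet> x))"
  for x :: "real ^ 'n"
  by (simp add: perturb_def inner_sum_left)

lemma eventually_perturb_pos: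
  fixes v :: "int ^ 'n"
  assumes "rational_order \<omega> 0 v"
  shows "\<forall>\<^sub>F \<eta> in at_right 0. 0 < int_vec v \<bullet> perturb \<omega> \<eta>"
proof -
  obtain k where "k < CARD('n)" "0 < rat_vec (\<omega> k) \<bullet> int_vec v"
    "\<And>j. j < k \<Longrightarrow> rat_vec (\<omega> j) \<bullet> int_vec v = 0"
    using assms unfolding rational_order_def by auto
  from eventually_sum_powers_pos[of k _ "\<lambda>i. rat_vec (\<omega> i) \<bullet> int_vec v", OF this]
  show ?thesis by (simp add: inner_perturb inner_commute[of "int_vec v"])
qed

text \<open>
  A basis of $\mathbb{Q}^n$ also spans $\mathbb{R}^n$. The vector \<open>x\<close> is real since it will be built
  from real inner products.
\<close>

lemma rat_basis_separates:
  fixes x :: "real ^ 'n"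
  assumes "rat_basis \<omega>" "x \<noteq> 0"
  shows "\<exists>k<CARD('n). rat_vec (\<omega> k) \<bullet> x \<noteq> 0"
proof (rule ccontr)
  assume "\<not> (\<exists>k<CARD('n). rat_vec (\<omega> k) \<bullet> x \<noteq> 0)"
  then have z: "\<omega> ` {..<CARD('n)} \<subseteq> {w. rat_vec w \<bullet> x = 0}" by auto
  have add: "rat_vec (u + w) = rat_vec u + rat_vec w" and scale: "rat_vec (c *s w) = of_rat c *\<^sub>R rat_vec w"
    for u w :: "rat ^ 'n" and c
    by (simp_all add: rat_vec_def vec_eq_iff of_rat_add of_rat_mult)
  have "vec.subspace {w. rat_vec w \<bullet> x = 0}"
    unfolding vec.subspace_def by (auto simp: add scale inner_add_left) (simp add: rat_vec_def inner_vec_def)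
  then have "vec.span (\<omega> ` {..<CARD('n)}) \<subseteq> {w. rat_vec w \<bullet> x = 0}"
    using z by (rule vec.span_minimal[rotated])
  then have "rat_vec w \<bullet> x = 0" for w using assms(1) by (auto simp: rat_basis_def)
  moreover have "rat_vec (axis i 1) \<bullet> x = x $ i" for i
  proof -
    have "rat_vec (axis i 1 :: rat ^ 'n) = axis i 1" by (simp add: rat_vec_def axis_def vec_eq_iff)
    then show ?thesis by (simp add: inner_axis')
  qed
  ultimately have "x = 0" by (simp add: vec_eq_iff)
  then show False using assms(2) by blast
qed

lemma eventually_perturb_nonzero:
  fixes x :: "real ^ 'n"
  assumes "rat_basis \<omega>" "x \<noteq> 0"
  shows "\<forall>\<^sub>F \<eta> in at_right 0. x \<bullet> perturb \<omega> \<eta> \<noteq> 0"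
proof -
  let ?P = "\<lambda>k. k < CARD('n) \<and> rat_vec (\<omega> k) \<bullet> x \<noteq> 0"
  define k where "k = (LEAST k. ?P k)"
  have k: "?P k" unfolding k_def using rat_basis_separates[OF assms] by (rule LeastI_ex)
  have less: "rat_vec (\<omega> j) \<bullet> x = 0" if "j < k" for j
    using not_less_Least[of j ?P] that k by (auto simp: k_def)
  have "\<forall>\<^sub>F \<eta> in at_right 0. 0 < y \<bullet> perturb \<omega> \<eta>" if "0 < rat_vec (\<omega> k) \<bullet> y" "y \<in> {x, - x}" for y
    using eventually_sum_powers_pos[of k "CARD('n)" "\<lambda>i. rat_vec (\<omega> i) \<bullet> y"] that k less
    by (auto simp: inner_perturb inner_commute[of y] inner_commute[of x])
  from this[of x] this[of "- x"] k have
    "(\<forall>\<^sub>F \<eta> in at_right 0. 0 < x \<bullet> perturb \<omega> \<eta>) \<or> (\<forall>\<^sub>F \<eta> in at_right 0. 0 < - x \<bullet> perturb \<omega> \<eta>)"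
    by (auto simp: neq_iff)
  then show ?thesis by (auto elim: eventually_mono)
qed

lemma eventually_at_right_0_rat:
  assumes "\<forall>\<^sub>F \<eta> in at_right (0::real). P \<eta>"
  obtains b :: rat where "0 < b" "\<And>\<eta>. 0 < \<eta> \<Longrightarrow> \<eta> < b \<Longrightarrow> P (real_of_rat \<eta>)"
proof -
  obtain c where c: "0 < c" "\<And>y. 0 < y \<Longrightarrow> y < c \<Longrightarrow> P y"
    using assms unfolding eventually_at_right_field by blast
  obtain b where b: "0 < real_of_rat b" "real_of_rat b < c" using of_rat_dense[OF c(1)] by auto
  show thesis
  proof
    show "0 < b" using b(1) by simp
    show "P (real_of_rat \<eta>)" if "0 < \<eta>" "\<eta> < b" for \<eta>
    proof (rule c(2))
      show "real_of_rat \<eta> < c" using b(2) that(2) of_rat_less[where 'a = real, of \<eta> b] by linarith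
    qed (use that(1) in simp)
  qed
qed

lemma eventually_normals_pos:
  fixes I :: "('n::finite, 'k::field) mpoly set"
  assumes "is_ideal I" "term_order (rational_order \<omega>)"
  shows "\<forall>\<^sub>F \<eta> in at_right 0. \<forall>v\<in>cone_normals (rational_order \<omega>) I. 0 < int_vec v \<bullet> perturb \<omega> \<eta>"
  using cone_normals_pos[OF assms] finite_cone_normals[OF assms] eventually_perturb_pos
  by (intro eventually_ball_finite) auto

lemma normals_pos_interior:
  fixes I :: "('n::finite, 'k::field) mpoly set"
  assumes "is_ideal I" "term_order prec" and pos: "\<forall>v\<in>cone_normals prec I. 0 < int_vec v \<bullet> p"
  shows "p \<in> interior (groebner_cone prec I)" and "0 < p $ i"
proof -
  have "p \<in> groebner_cone prec I" using pos by (auto simp: groebner_cone_eq less_imp_le)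
  then show "p \<in> interior (groebner_cone prec I)"
    using cone_point.mem_interior_if_off_walls[OF cone_point_groebner_cone[OF assms(1,2)]] pos by force
  have "axis i 1 \<in> cone_normals prec I" by (simp add: cone_normals_def)
  then show "0 < p $ i" using pos by (force simp: int_vec_axis inner_axis')
qed

text \<open>
  If a point of the segment is orthogonal to both \<open>v\<close> and \<open>w\<close>, then its barycentric coordinates solve a
  homogeneous linear system in two unknowns, so the determinant of that system vanishes. Read as a
  linear form in \<open>r\<close>, the determinant is the product of \<open>r\<close> with
  $\langle v,q\rangle w-\langle w,q\rangle v$; this vector must then be zero, which makes \<open>v\<close> and \<open>w\<close>
  parallel because $\langle v,q\rangle\neq0$.
\<close>

lemma segment_generic:
  fixes I :: "('n::finite, 'k::field) mpoly set"
  assumes q: "\<And>i. 0 < q $ i" and r: "\<And>i. 0 < r $ i"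
    and q_off: "\<And>v. v \<in> fan_diffs I \<Longrightarrow> int_vec v \<bullet> q \<noteq> 0"
    and r_off: "\<And>v w. v \<in> fan_diffs I \<Longrightarrow> w \<in> fan_diffs I \<Longrightarrow>
      (int_vec v \<bullet> q) *\<^sub>R int_vec w \<noteq> (int_vec w \<bullet> q) *\<^sub>R int_vec v \<Longrightarrow>
      ((int_vec v \<bullet> q) *\<^sub>R int_vec w - (int_vec w \<bullet> q) *\<^sub>R int_vec v) \<bullet> r \<noteq> 0"
    and t: "0 \<le> t" "t \<le> 1"
  shows "generic I ((1 - t) *\<^sub>R q + t *\<^sub>R r)"
  unfolding generic_def
proof (intro conjI allI ballI impI)
  show "0 < ((1 - t) *\<^sub>R q + t *\<^sub>R r) $ i" for i
  proof (cases "t = 0")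
    case False
    then show ?thesis using q[of i] r[of i] t
      by (auto intro!: add_nonneg_pos)
  qed (use q[of i] in simp)
  fix v w
  assume vw: "v \<in> fan_diffs I" "w \<in> fan_diffs I"
    and "int_vec v \<bullet> ((1 - t) *\<^sub>R q + t *\<^sub>R r) = 0 \<and> int_vec w \<bullet> ((1 - t) *\<^sub>R q + t *\<^sub>R r) = 0"
  then have e: "(1 - t) * (int_vec v \<bullet> q) + t * (int_vec v \<bullet> r) = 0"
    "(1 - t) * (int_vec w \<bullet> q) + t * (int_vec w \<bullet> r) = 0"
    by (simp_all add: inner_add_right)
  have "t \<noteq> 0" using e(1) q_off[OF vw(1)] by auto
  have "t * ((int_vec v \<bullet> q) * (int_vec w \<bullet> r) - (int_vec w \<bullet> q) * (int_vec v \<bullet> r)) =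
    (int_vec v \<bullet> q) * ((1 - t) * (int_vec w \<bullet> q) + t * (int_vec w \<bullet> r)) -
    (int_vec w \<bullet> q) * ((1 - t) * (int_vec v \<bullet> q) + t * (int_vec v \<bullet> r))"
    by (simp add: algebra_simps)
  then have "((int_vec v \<bullet> q) *\<^sub>R int_vec w - (int_vec w \<bullet> q) *\<^sub>R int_vec v) \<bullet> r = 0"
    using e \<open>t \<noteq> 0\<close> by (simp add: inner_diff_left)
  then have "(int_vec v \<bullet> q) *\<^sub>R int_vec w = (int_vec w \<bullet> q) *\<^sub>R int_vec v"
    using r_off[OF vw] by blast
  then have "int_vec w = ((int_vec w \<bullet> q) / (int_vec v \<bullet> q)) *\<^sub>R int_vec v"
    using q_off[OF vw(1)] by (metis (no_types, lifting) divide_inverse_commute eq_vector_fraction_iff scaleR_scaleR times_divide_eq_right)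
  then show "\<exists>c. int_vec w = c *\<^sub>R int_vec v" ..
qed

theorem mainTheorem3:
  fixes I :: "('n::finite, 'k::field) mpoly set"
    and \<omega> \<tau> :: "nat \<Rightarrow> rat ^ 'n"
  assumes "is_ideal I"
    and "rat_basis \<omega>" and "term_order (rational_order \<omega>)"
    and "rat_basis \<tau>" and "term_order (rational_order \<tau>)"
  shows "\<exists>\<delta>0>0::rat. \<forall>\<delta>. 0 < \<delta> \<and> \<delta> < \<delta>0 \<longrightarrow>
    (\<exists>\<epsilon>0>0::rat. \<forall>\<epsilon>. 0 < \<epsilon> \<and> \<epsilon> < \<epsilon>0 \<longrightarrow>
      rat_vec (perturbed \<omega> \<delta>) \<in> interior (groebner_cone (rational_order \<omega>) I) \<and>
      rat_vec (perturbed \<tau> \<epsilon>) \<in> interior (groebner_cone (rational_order \<tau>) I) \<and>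
      (\<forall>t::real. 0 \<le> t \<and> t \<le> 1 \<longrightarrow>
        (let p = (1 - t) *\<^sub>R rat_vec (perturbed \<omega> \<delta>) + t *\<^sub>R rat_vec (perturbed \<tau> \<epsilon>) in
          (\<exists>F\<in>groebner_fan I. (dim F = CARD('n) \<or> dim F = CARD('n) - 1) \<and> p \<in> rel_interior F) \<and>
          (\<forall>prec F. term_order prec \<and> cone_face F (groebner_cone prec I) \<and>
              F \<noteq> groebner_cone prec I \<and> p \<in> F \<longrightarrow>
            (\<exists>F'. cone_facet F' (groebner_cone prec I) \<and> p \<in> F' \<and>
              (\<forall>F''. cone_face F'' (groebner_cone prec I) \<and> p \<in> F'' \<longrightarrow> F' \<subseteq> F''))))))"
proof -
  note I = assms(1) and \<omega> = assms(2,3) and \<tau> = assms(4,5)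
  let ?N = "\<lambda>\<sigma>. cone_normals (rational_order \<sigma>) I"
  have nz: "int_vec v \<noteq> 0" if v: "v \<in> fan_diffs I" for v
  proof -
    obtain prec where "term_order prec" "v \<in> cone_normals prec I"
      using v unfolding fan_diffs_def cone_normals_def by blast
    then have "prec 0 v" "\<not> prec 0 0" by (auto intro: cone_normals_pos[OF I] simp: term_order_irrefl)
    then show ?thesis unfolding int_vec_eq_0_iff by blast
  qed
  have "\<forall>\<^sub>F \<delta> in at_right 0. (\<forall>v\<in>?N \<omega>. 0 < int_vec v \<bullet> perturb \<omega> \<delta>) \<and>
      (\<forall>v\<in>fan_diffs I. int_vec v \<bullet> perturb \<omega> \<delta> \<noteq> 0)"
    using eventually_perturb_nonzero[OF \<omega>(1)] nz finite_fan_diffs[OF I]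
    by (intro eventually_conj[OF eventually_normals_pos[OF I \<omega>(2)] eventually_ball_finite]) auto
  then obtain \<delta>0 :: rat where \<delta>0: "0 < \<delta>0" and
    \<delta>: "\<And>\<delta>. 0 < \<delta> \<Longrightarrow> \<delta> < \<delta>0 \<Longrightarrow> \<forall>v\<in>?N \<omega>. 0 < int_vec v \<bullet> rat_vec (perturbed \<omega> \<delta>)"
       "\<And>\<delta>. 0 < \<delta> \<Longrightarrow> \<delta> < \<delta>0 \<Longrightarrow> \<forall>v\<in>fan_diffs I. int_vec v \<bullet> rat_vec (perturbed \<omega> \<delta>) \<noteq> 0"
    unfolding rat_vec_perturbed by (rule eventually_at_right_0_rat) blast
  show ?thesis
  proof (rule exI[of _ \<delta>0], intro conjI \<delta>0 allI impI)
    fix \<delta> assume "0 < \<delta> \<and> \<delta> < \<delta>0"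
    then have pos: "0 < \<delta>" and less: "\<delta> < \<delta>0" by auto
    define q where "q = rat_vec (perturbed \<omega> \<delta>)"
    \<comment> \<open>for non-parallel \<open>v\<close>, \<open>w\<close>: the normal of the hyperplane through \<open>q\<close> that contains all
      vectors orthogonal to both \<open>v\<close> and \<open>w\<close>\<close>
    let ?x = "\<lambda>v w. (int_vec v \<bullet> q) *\<^sub>R int_vec w - (int_vec w \<bullet> q) *\<^sub>R int_vec v"
    have "\<forall>\<^sub>F \<epsilon> in at_right 0. (\<forall>v\<in>?N \<tau>. 0 < int_vec v \<bullet> perturb \<tau> \<epsilon>) \<and>
        (\<forall>v\<in>fan_diffs I. \<forall>w\<in>fan_diffs I. ?x v w \<noteq> 0 \<longrightarrow> ?x v w \<bullet> perturb \<tau> \<epsilon> \<noteq> 0)"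
    proof (intro eventually_conj[OF eventually_normals_pos[OF I \<tau>(2)]] eventually_ball_finite
        finite_fan_diffs[OF I] ballI)
      fix v w
      show "\<forall>\<^sub>F \<epsilon> in at_right 0. ?x v w \<noteq> 0 \<longrightarrow> ?x v w \<bullet> perturb \<tau> \<epsilon> \<noteq> 0"
        using eventually_perturb_nonzero[OF \<tau>(1), of "?x v w"] by (cases "?x v w = 0") auto
    qed
    then obtain \<epsilon>0 :: rat where \<epsilon>0: "0 < \<epsilon>0" and
      \<epsilon>: "\<And>\<epsilon>. 0 < \<epsilon> \<Longrightarrow> \<epsilon> < \<epsilon>0 \<Longrightarrow> \<forall>v\<in>?N \<tau>. 0 < int_vec v \<bullet> rat_vec (perturbed \<tau> \<epsilon>)"
         "\<And>\<epsilon>. 0 < \<epsilon> \<Longrightarrow> \<epsilon> < \<epsilon>0 \<Longrightarrow> \<forall>v\<in>fan_diffs I. \<forall>w\<in>fan_diffs I.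
            ?x v w \<noteq> 0 \<longrightarrow> ?x v w \<bullet> rat_vec (perturbed \<tau> \<epsilon>) \<noteq> 0"
      unfolding rat_vec_perturbed by (rule eventually_at_right_0_rat) blast
    show "\<exists>\<epsilon>0>0::rat. \<forall>\<epsilon>. 0 < \<epsilon> \<and> \<epsilon> < \<epsilon>0 \<longrightarrow>
      rat_vec (perturbed \<omega> \<delta>) \<in> interior (groebner_cone (rational_order \<omega>) I) \<and>
      rat_vec (perturbed \<tau> \<epsilon>) \<in> interior (groebner_cone (rational_order \<tau>) I) \<and>
      (\<forall>t::real. 0 \<le> t \<and> t \<le> 1 \<longrightarrow>
        (let p = (1 - t) *\<^sub>R rat_vec (perturbed \<omega> \<delta>) + t *\<^sub>R rat_vec (perturbed \<tau> \<epsilon>) in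
          (\<exists>F\<in>groebner_fan I. (dim F = CARD('n) \<or> dim F = CARD('n) - 1) \<and> p \<in> rel_interior F) \<and>
          (\<forall>prec F. term_order prec \<and> cone_face F (groebner_cone prec I) \<and>
              F \<noteq> groebner_cone prec I \<and> p \<in> F \<longrightarrow>
            (\<exists>F'. cone_facet F' (groebner_cone prec I) \<and> p \<in> F' \<and>
              (\<forall>F''. cone_face F'' (groebner_cone prec I) \<and> p \<in> F'' \<longrightarrow> F' \<subseteq> F'')))))"
      unfolding q_def[symmetric]
    proof (rule exI[of _ \<epsilon>0], intro conjI \<epsilon>0 allI impI)
      fix \<epsilon> assume "0 < \<epsilon> \<and> \<epsilon> < \<epsilon>0"
      then have ee: "0 < \<epsilon>" "\<epsilon> < \<epsilon>0" by auto
      define r where "r = rat_vec (perturbed \<tau> \<epsilon>)"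
      note q = normals_pos_interior[OF I \<omega>(2) \<delta>(1)[OF pos less], folded q_def]
      note r = normals_pos_interior[OF I \<tau>(2) \<epsilon>(1)[OF ee], folded r_def]
      show "q \<in> interior (groebner_cone (rational_order \<omega>) I)" by (fact q(1))
      show "rat_vec (perturbed \<tau> \<epsilon>) \<in> interior (groebner_cone (rational_order \<tau>) I)"
        using r(1) by (simp add: r_def)
      fix t :: real assume t: "0 \<le> t \<and> t \<le> 1"
      have gen: "generic I ((1 - t) *\<^sub>R q + t *\<^sub>R r)"
        using \<delta>(2)[OF pos less] \<epsilon>(2)[OF ee] t
        by (intro segment_generic q(2) r(2)) (auto simp: q_def r_def)
      show "let p = (1 - t) *\<^sub>R q + t *\<^sub>R rat_vec (perturbed \<tau> \<epsilon>) in
          (\<exists>F\<in>groebner_fan I. (dim F = CARD('n) \<or> dim F = CARD('n) - 1) \<and> p \<in> rel_interior F) \<and>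
          (\<forall>prec F. term_order prec \<and> cone_face F (groebner_cone prec I) \<and>
              F \<noteq> groebner_cone prec I \<and> p \<in> F \<longrightarrow>
            (\<exists>F'. cone_facet F' (groebner_cone prec I) \<and> p \<in> F' \<and>
              (\<forall>F''. cone_face F'' (groebner_cone prec I) \<and> p \<in> F'' \<longrightarrow> F' \<subseteq> F'')))"
        unfolding Let_def r_def[symmetric]
        using generic_in_fan_cone[OF I \<omega>(2) gen] generic_smallest_face[OF I _ gen] by blast
    qed
  qed
qed

end
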